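(* Let $n\ge1$, let $P$ be a finite partially ordered set, and let $\mathcal J$ be a poset ideal in $\mathrm{Hom}(P,[n])$. Then the ideal $L(P,n;\mathcal J)\subseteq\Bbbk[x_{P\times[n]}]$ has linear quotients, and so it has linear resolution.
   Context: $\Bbbk$ is a field and $[n]=\{1<2<\cdots<n\}$ is the chain on $n$ elements. For a set $A$, $\Bbbk[x_A]$ is the polynomial ring in variables $x_a$, $a\in A$. $\mathrm{Hom}(P,[n])$ is the set of isotone (order preserving) maps $P\to[n]$, partially ordered by $\phi\le\psi$ iff $\phi(p)\le\psi(p)$ for all $p\in P$. A poset ideal of a poset is a subset $J$ such that $q\in J$ and $p\le q$ imply $p\in J$. The co-letterplace ideal $L(P,n;\mathcal J)\subseteq\Bbbk[x_{P\times[n]}]$ is generated by all monomials $\prod_{p\in P}x_{p,\phi(p)}$ with $\phi\in\mathcal J$. A monomial ideal has linear quotients if its minimal monomial generators can be ordered $m_1,\dots,m_r$ so that for each $j\geq 2$ the colon ideal $(m_1,\dots,m_{j-1}):m_j$ is generated by a subset of the variables. A homogeneous ideal generated in a single degree $d$ has linear resolution if its minimal graded free resolution is linear, i.e. its graded Betti numbers $\beta_{i,j}$ vanish unless $j=i+d$. *)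

theory Defs
  imports "HOL-Algebra.Ideal" "HOL-Library.Poly_Mapping" "HOL-Library.FuncSet"
begin

section \<open>Polynomial rings over a set of variables\<close>

text \<open>
  An exponent vector is a finitely supported map from variables to naturals, and
  convolution on \<^theory>\<open>HOL-Library.Poly_Mapping\<close> makes the finitely supported functions on
  exponent vectors a commutative ring.  For a set \<open>A\<close> of variables, \<open>poly_ring A\<close> is the subring
  of the polynomials in which only variables from \<open>A\<close> occur, so that ideals are
  ideals of this ring and not of the one with all elements of the type as variables.
\<close>

type_synonym ('v, 'k) mpoly = "('v \<Rightarrow>\<^sub>0 nat) \<Rightarrow>\<^sub>0 'k"

definition polys :: "'v set \<Rightarrow> ('v, 'k::field) mpoly set" where
  "polys A = {f. \<forall>m\<in>Poly_Mapping.keys f. Poly_Mapping.keys m \<subseteq> A}"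

definition poly_ring :: "'v set \<Rightarrow> ('v, 'k::field) mpoly ring" where
  "poly_ring A = \<lparr>carrier = polys A, mult = (*), one = 1, zero = 0, add = (+)\<rparr>"

definition monomial :: "('v \<Rightarrow>\<^sub>0 nat) \<Rightarrow> ('v, 'k::field) mpoly" where
  "monomial m = Poly_Mapping.single m 1"

definition var :: "'v \<Rightarrow> ('v, 'k::field) mpoly" where
  "var v = monomial (Poly_Mapping.single v 1)"

definition monomials :: "'v set \<Rightarrow> ('v, 'k::field) mpoly set" where
  "monomials A = {monomial m | m. Poly_Mapping.keys m \<subseteq> A}"

definition mdeg :: "('v \<Rightarrow>\<^sub>0 nat) \<Rightarrow> nat" where
  "mdeg m = (\<Sum>v\<in>Poly_Mapping.keys m. Poly_Mapping.lookup m v)"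

definition homogeneous :: "nat \<Rightarrow> ('v, 'k::field) mpoly \<Rightarrow> bool" where
  "homogeneous d f \<longleftrightarrow> (\<forall>m\<in>Poly_Mapping.keys f. mdeg m = d)"

lemma polys_add: "f \<in> polys A \<Longrightarrow> g \<in> polys A \<Longrightarrow> f + g \<in> polys A"
  using Poly_Mapping.keys_add[of f g] by (auto simp: polys_def)

lemma polys_mult: "f \<in> polys A \<Longrightarrow> g \<in> polys A \<Longrightarrow> f * g \<in> polys A"
proof -
  assume f: "f \<in> polys A" and g: "g \<in> polys A"
  have "Poly_Mapping.keys m \<subseteq> A" if m: "m \<in> Poly_Mapping.keys (f * g)" for m
  proof -
    obtain a b where "a \<in> Poly_Mapping.keys f" "b \<in> Poly_Mapping.keys g" "m = a + b"
      using m keys_mult[of f g] by blast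
    then show ?thesis
      using f g Poly_Mapping.keys_add[of a b] unfolding polys_def by blast
  qed
  then show ?thesis by (simp add: polys_def)
qed

lemma cring_poly_ring: "cring (poly_ring A :: ('v, 'k::field) mpoly ring)"
proof (rule cringI)
  show "abelian_group (poly_ring A :: ('v, 'k) mpoly ring)"
  proof (rule abelian_groupI)
    fix f :: "('v, 'k) mpoly" assume "f \<in> carrier (poly_ring A)"
    then have "- f \<in> carrier (poly_ring A)" by (simp add: poly_ring_def polys_def)
    then show "\<exists>g\<in>carrier (poly_ring A). g \<oplus>\<^bsub>poly_ring A\<^esub> f = \<zero>\<^bsub>poly_ring A\<^esub>"
      by (intro bexI[of _ "- f"]) (auto simp: poly_ring_def)
  qed (auto simp: poly_ring_def polys_add add_ac, auto simp: polys_def)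
  show "comm_monoid (poly_ring A :: ('v, 'k) mpoly ring)"
    by (rule comm_monoidI) (auto simp: poly_ring_def polys_mult mult_ac, auto simp: polys_def)
qed (auto simp: poly_ring_def algebra_simps)

section \<open>Linear quotients\<close>

definition colon_ideal ::
    "'v set \<Rightarrow> ('v, 'k::field) mpoly set \<Rightarrow> ('v, 'k) mpoly \<Rightarrow> ('v, 'k) mpoly set" where
  "colon_ideal A I f = {g \<in> polys A. g * f \<in> I}"

definition minimal_monomial_generators ::
    "'v set \<Rightarrow> ('v, 'k::field) mpoly set \<Rightarrow> ('v, 'k) mpoly set \<Rightarrow> bool" where
  "minimal_monomial_generators A I G \<longleftrightarrow>
     G \<subseteq> monomials A \<and> Idl\<^bsub>poly_ring A\<^esub> G = I \<and> (\<forall>G'. G' \<subset> G \<longrightarrow> Idl\<^bsub>poly_ring A\<^esub> G' \<noteq> I)"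

text \<open>
  The list \<open>ms\<close> is indexed from 0, so \<open>take j ms\<close> lists all generators preceding \<open>ms ! j\<close>.
\<close>

definition has_linear_quotients :: "'v set \<Rightarrow> ('v, 'k::field) mpoly set \<Rightarrow> bool" where
  "has_linear_quotients A I \<longleftrightarrow>
     (\<exists>ms. distinct ms \<and> minimal_monomial_generators A I (set ms) \<and>
        (\<forall>j. 1 \<le> j \<and> j < length ms \<longrightarrow>
           (\<exists>V\<subseteq>A. colon_ideal A (Idl\<^bsub>poly_ring A\<^esub> (set (take j ms))) (ms ! j)
                 = Idl\<^bsub>poly_ring A\<^esub> (var ` V))))"

section \<open>Minimal graded free resolutions\<close>

text \<open>
  A complex of graded free modules \<open>F\<^sub>i = \<Oplus>\<^bsub>a < rk i\<^esub> S(- sh i a)\<close> of finite rank over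
  \<open>S = poly_ring A\<close> is given by the ranks \<open>rk\<close>, the degrees \<open>sh i a\<close> of the basis elements, and the
  images of the basis elements: \<open>D i a \<in> F\<^sub>i\<close> is the image of the \<open>a\<close>-th basis
  element of \<open>F\<^bsub>i+1\<^esub>\<close>, and \<open>\<epsilon> a \<in> I\<close> that of the \<open>a\<close>-th basis element of \<open>F\<^sub>0\<close> under
  the augmentation \<open>F\<^sub>0 \<rightarrow> I\<close>.  Vectors are padded with zeros outside the index range, so that
  equality of functions is equality in the module.
\<close>

definition free_module :: "'v set \<Rightarrow> nat \<Rightarrow> (nat \<Rightarrow> ('v, 'k::field) mpoly) set" where
  "free_module A r = {v. (\<forall>a<r. v a \<in> polys A) \<and> (\<forall>a\<ge>r. v a = 0)}"

definition aug :: "nat \<Rightarrow> (nat \<Rightarrow> ('v, 'k::field) mpoly) \<Rightarrow> (nat \<Rightarrow> ('v, 'k) mpoly) \<Rightarrow> ('v, 'k) mpoly" where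
  "aug r \<epsilon> v = (\<Sum>a<r. v a * \<epsilon> a)"

definition diff_map ::
    "nat \<Rightarrow> (nat \<Rightarrow> nat \<Rightarrow> ('v, 'k::field) mpoly) \<Rightarrow> (nat \<Rightarrow> ('v, 'k) mpoly) \<Rightarrow> (nat \<Rightarrow> ('v, 'k) mpoly)" where
  "diff_map r M v = (\<lambda>b. \<Sum>a<r. v a * M a b)"

definition graded_free_resolution ::
    "'v set \<Rightarrow> ('v, 'k::field) mpoly set \<Rightarrow> (nat \<Rightarrow> nat) \<Rightarrow> (nat \<Rightarrow> nat \<Rightarrow> nat) \<Rightarrow>
     (nat \<Rightarrow> ('v, 'k) mpoly) \<Rightarrow> (nat \<Rightarrow> nat \<Rightarrow> nat \<Rightarrow> ('v, 'k) mpoly) \<Rightarrow> bool" where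
  "graded_free_resolution A I rk sh \<epsilon> D \<longleftrightarrow>
     \<comment> \<open>all maps are graded of degree 0\<close>
     (\<forall>a<rk 0. \<epsilon> a \<in> polys A \<and> homogeneous (sh 0 a) (\<epsilon> a)) \<and>
     (\<forall>i. \<forall>a<rk (Suc i). D i a \<in> free_module A (rk i) \<and>
        (\<forall>b<rk i. \<forall>m\<in>Poly_Mapping.keys (D i a b). sh i b + mdeg m = sh (Suc i) a)) \<and>
     \<comment> \<open>\<open>\<dots> \<rightarrow> F\<^sub>1 \<rightarrow> F\<^sub>0 \<rightarrow> I \<rightarrow> 0\<close> is exact\<close>
     aug (rk 0) \<epsilon> ` free_module A (rk 0) = I \<and>
     {v \<in> free_module A (rk 0). aug (rk 0) \<epsilon> v = 0}
       = diff_map (rk 1) (D 0) ` free_module A (rk 1) \<and>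
     (\<forall>i. {v \<in> free_module A (rk (Suc i)). diff_map (rk (Suc i)) (D i) v = (\<lambda>_. 0)}
       = diff_map (rk (Suc (Suc i))) (D (Suc i)) ` free_module A (rk (Suc (Suc i))))"

text \<open>Minimality: the image of \<open>F\<^bsub>i+1\<^esub>\<close> lies in \<open>\<mm> F\<^sub>i\<close>, where \<open>\<mm>\<close> is generated by the variables.\<close>

definition minimal_graded_free_resolution ::
    "'v set \<Rightarrow> ('v, 'k::field) mpoly set \<Rightarrow> (nat \<Rightarrow> nat) \<Rightarrow> (nat \<Rightarrow> nat \<Rightarrow> nat) \<Rightarrow>
     (nat \<Rightarrow> ('v, 'k) mpoly) \<Rightarrow> (nat \<Rightarrow> nat \<Rightarrow> nat \<Rightarrow> ('v, 'k) mpoly) \<Rightarrow> bool" where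
  "minimal_graded_free_resolution A I rk sh \<epsilon> D \<longleftrightarrow>
     graded_free_resolution A I rk sh \<epsilon> D \<and>
     (\<forall>i. \<forall>a<rk (Suc i). \<forall>b<rk i. D i a b \<in> Idl\<^bsub>poly_ring A\<^esub> (var ` A))"

definition graded_betti :: "(nat \<Rightarrow> nat) \<Rightarrow> (nat \<Rightarrow> nat \<Rightarrow> nat) \<Rightarrow> nat \<Rightarrow> nat \<Rightarrow> nat" where
  "graded_betti rk sh i j = card {a. a < rk i \<and> sh i a = j}"

definition generated_in_degree :: "'v set \<Rightarrow> nat \<Rightarrow> ('v, 'k::field) mpoly set \<Rightarrow> bool" where
  "generated_in_degree A d I \<longleftrightarrow>
     (\<exists>G\<subseteq>polys A. (\<forall>g\<in>G. homogeneous d g) \<and> I = Idl\<^bsub>poly_ring A\<^esub> G)"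

text \<open>
  Minimal graded free resolutions of an ideal are unique up to isomorphism, so the graded Betti
  numbers of \<open>I\<close> are those of any one of them.  The degree \<open>d\<close> is determined by \<open>I\<close> unless \<open>I = 0\<close>.
\<close>

definition has_linear_resolution :: "'v set \<Rightarrow> ('v, 'k::field) mpoly set \<Rightarrow> bool" where
  "has_linear_resolution A I \<longleftrightarrow>
     (\<exists>d. generated_in_degree A d I \<and>
       (\<exists>rk sh \<epsilon> D. minimal_graded_free_resolution A I rk sh \<epsilon> D \<and>
          (\<forall>i j. j \<noteq> i + d \<longrightarrow> graded_betti rk sh i j = 0)))"

section \<open>Co-letterplace ideals\<close>

text \<open>
  Isotone maps are taken as extensional functions, so that two maps which agree
  on \<open>P\<close> are equal.
\<close>

definition isotone_maps :: "'p set \<Rightarrow> 'p rel \<Rightarrow> nat \<Rightarrow> ('p \<Rightarrow> nat) set" where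
  "isotone_maps P r n =
     {\<phi> \<in> P \<rightarrow>\<^sub>E {1..n}. monotone_on P (\<lambda>p q. (p, q) \<in> r) (\<le>) \<phi>}"

definition pointwise_le :: "'p set \<Rightarrow> ('p \<Rightarrow> nat) \<Rightarrow> ('p \<Rightarrow> nat) \<Rightarrow> bool" where
  "pointwise_le P \<phi> \<psi> \<longleftrightarrow> (\<forall>p\<in>P. \<phi> p \<le> \<psi> p)"

definition poset_ideal :: "'a set \<Rightarrow> ('a \<Rightarrow> 'a \<Rightarrow> bool) \<Rightarrow> 'a set \<Rightarrow> bool" where
  "poset_ideal X ord J \<longleftrightarrow> J \<subseteq> X \<and> (\<forall>q\<in>J. \<forall>p\<in>X. ord p q \<longrightarrow> p \<in> J)"

definition co_letterplace_ideal ::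
    "'p set \<Rightarrow> nat \<Rightarrow> ('p \<Rightarrow> nat) set \<Rightarrow> ('p \<times> nat, 'k::field) mpoly set" where
  "co_letterplace_ideal P n J =
     Idl\<^bsub>poly_ring (P \<times> {1..n})\<^esub> ((\<lambda>\<phi>. \<Prod>p\<in>P. var (p, \<phi> p)) ` J)"

end

theory Submission
  imports Defs
begin

text \<open>
  The generator of an isotone map \<open>\<phi>\<close> is the squarefree monomial \<open>m\<^sub>\<phi> = \<Prod>\<^bsub>p\<in>P\<^esub> x\<^bsub>p,\<phi> p\<^esub>\<close> of the graph
  of \<open>\<phi>\<close>, so all generators have degree \<open>card P\<close>.  They are ordered by increasing
  \<open>\<Sum>\<^bsub>p\<in>P\<^esub> \<phi> p\<close>, which refines the pointwise order.  If \<open>\<psi>\<close> comes before \<open>\<phi>\<close>, then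
  \<open>\<psi> p < \<phi> p\<close> for some \<open>p\<close>; at an \<open>r\<close>-minimal such \<open>p\<close> the value of \<open>\<phi>\<close> can be lowered to \<open>\<psi> p\<close>
  without losing isotonicity (\<open>isotone_lowering\<close>).  The lowered map lies in the poset ideal \<open>J\<close> and
  comes before \<open>\<phi>\<close>, and \<open>x\<^bsub>p,\<psi> p\<^esub>\<close> both divides \<open>m\<^sub>\<psi> / gcd(m\<^sub>\<psi>, m\<^sub>\<phi>)\<close> and multiplies \<open>m\<^sub>\<phi>\<close> to a multiple
  of the monomial of the lowered map.  Hence the colon ideal of \<open>m\<^sub>\<phi>\<close> is generated by the variables
  \<open>x\<^bsub>p,i\<^esub>\<close> with \<open>i < \<phi> p\<close> and \<open>\<phi>(p := i) \<in> J\<close> (\<open>earlier_monomial_divides_iff\<close>).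

  The linear resolution comes from linear quotients alone.  Instead of iterated mapping cones, which
  need comparison maps between complexes, the argument extends the notion of linear quotients from
  ideals to submodules of free modules: a list of homogeneous vectors \<open>g\<^sub>1, \<dots>, g\<^sub>k\<close> of one degree, such
  that each colon ideal \<open>{f. f g\<^sub>j \<in> \<langle>g\<^sub>1, \<dots>, g\<^bsub>j-1\<^esub>\<rangle>}\<close> is generated by a finite set \<open>V\<^sub>j\<close> of variables.
  This property passes from a list to its module of syzygies, with generators whose entries are
  linear forms (\<open>linear_quotient_list_syzygies\<close>).  Indeed, each \<open>x \<in> V\<^sub>j\<close> gives a syzygy
  \<open>s\<^bsub>j,x\<^esub> = x e\<^sub>j - \<Sum>\<^bsub>i<j\<^esub> c\<^sub>i e\<^sub>i\<close> with linear coefficients \<open>c\<^sub>i\<close>.  List these by increasing \<open>j\<close>, and for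
  fixed \<open>j\<close> in any order of \<open>V\<^sub>j\<close>.  The part of the list up to some point spans exactly the
  syzygies of \<open>g\<^sub>1, \<dots>, g\<^sub>j\<close> whose \<open>j\<close>-th coefficient lies in the ideal \<open>(W)\<close>, where \<open>W \<subseteq> V\<^sub>j\<close> is the set
  of variables already treated.  Thus \<open>f s\<^bsub>j,x\<^esub>\<close> lies in that span iff \<open>f x \<in> (W)\<close>, that is, iff
  \<open>f \<in> (W)\<close>: the colon ideal is again generated by variables.

  Taking syzygies over and over gives a free resolution all of whose differentials have
  linear entries.  It is minimal, since linear forms lie in the ideal of the variables, and its
  \<open>i\<close>-th module is generated in degree \<open>i + d\<close>.
\<close>

section \<open>Polynomials and their monomials\<close>

lemma lookup_sum_single:
  assumes "finite B"
  shows "Poly_Mapping.lookup (\<Sum>u\<in>B. Poly_Mapping.single u (c u)) x = (if x \<in> B then c x else 0)"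
  using assms by (simp add: lookup_sum lookup_single when_def)

lemma sum_single_lookup:
  "(\<Sum>u\<in>Poly_Mapping.keys f. Poly_Mapping.single u (Poly_Mapping.lookup f u)) = f"
  by (rule poly_mapping_eqI) (simp add: lookup_sum_single in_keys_iff)

text \<open>
  Cutting a polynomial by a property of its monomials serves twice: it extracts homogeneous
  components, and it separates the multiples of a variable from the rest.
\<close>

lemma split_by_monomials:
  fixes f :: "('v, 'k::field) mpoly"
  obtains g h where "f = g + h"
    and "Poly_Mapping.keys g = {m \<in> Poly_Mapping.keys f. Q m}"
    and "Poly_Mapping.keys h = {m \<in> Poly_Mapping.keys f. \<not> Q m}"
proof -
  define part where
    "part R = (\<Sum>u\<in>{m \<in> Poly_Mapping.keys f. R m}. Poly_Mapping.single u (Poly_Mapping.lookup f u))"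
    for R
  have lookup_part: "Poly_Mapping.lookup (part R) x = (if R x then Poly_Mapping.lookup f x else 0)" for R x
    by (simp add: part_def lookup_sum_single in_keys_iff)
  have keys_part: "Poly_Mapping.keys (part R) = {m \<in> Poly_Mapping.keys f. R m}" for R
    by (auto simp: in_keys_iff lookup_part split: if_splits)
  have "f = part Q + part (\<lambda>m. \<not> Q m)"
    by (rule poly_mapping_eqI) (simp add: lookup_add lookup_part)
  then show thesis
    by (rule that[OF _ keys_part keys_part])
qed

lemma sum_single_mult_monomial:
  "f * monomial m
     = (\<Sum>u\<in>Poly_Mapping.keys f. Poly_Mapping.single (u + m) (Poly_Mapping.lookup f u))"
proof -
  have "f * monomial m
      = (\<Sum>u\<in>Poly_Mapping.keys f. Poly_Mapping.single u (Poly_Mapping.lookup f u)) * monomial m"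
    by (simp add: sum_single_lookup)
  also have "\<dots> = (\<Sum>u\<in>Poly_Mapping.keys f. Poly_Mapping.single (u + m) (Poly_Mapping.lookup f u))"
    by (simp add: sum_distrib_right monomial_def mult_single)
  finally show ?thesis .
qed

text \<open>
  Multiplication by a monomial shifts exponents injectively, so no terms cancel and the support of
  the product is known exactly, not only up to inclusion.
\<close>

lemma keys_mult_monomial:
  fixes f :: "('v, 'k::field) mpoly"
  shows "Poly_Mapping.keys (f * monomial m) = (\<lambda>u. u + m) ` Poly_Mapping.keys f"
proof
  show "Poly_Mapping.keys (f * monomial m) \<subseteq> (\<lambda>u. u + m) ` Poly_Mapping.keys f"
    using keys_mult[of f "monomial m"] by (auto simp: monomial_def)
  show "(\<lambda>u. u + m) ` Poly_Mapping.keys f \<subseteq> Poly_Mapping.keys (f * monomial m)"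
    by (auto simp: sum_single_mult_monomial in_keys_iff lookup_sum lookup_single when_def)
qed

lemma divide_by_monomial:
  fixes f :: "('v, 'k::field) mpoly"
  assumes "\<And>m. m \<in> Poly_Mapping.keys f \<Longrightarrow> \<exists>u. m = u + m0" and f: "f \<in> polys A"
  obtains h where "h \<in> polys A" and "f = h * monomial m0"
proof -
  define h where
    "h = (\<Sum>m\<in>Poly_Mapping.keys f. Poly_Mapping.single (m - m0) (Poly_Mapping.lookup f m))"
  have sub: "m - m0 + m0 = m" if "m \<in> Poly_Mapping.keys f" for m
    using assms(1)[OF that] by auto
  have "h * monomial m0
      = (\<Sum>m\<in>Poly_Mapping.keys f. Poly_Mapping.single m (Poly_Mapping.lookup f m))"
    unfolding h_def by (simp add: sum_distrib_right monomial_def mult_single sub)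
  then have eq: "f = h * monomial m0"
    by (simp add: sum_single_lookup)
  have "Poly_Mapping.keys u \<subseteq> A" if "u \<in> Poly_Mapping.keys h" for u
  proof -
    have "u + m0 \<in> Poly_Mapping.keys f"
      using that by (subst eq) (simp add: keys_mult_monomial)
    then have "Poly_Mapping.keys (u + m0) \<subseteq> A"
      using f by (auto simp: polys_def)
    then show ?thesis
      by (auto simp: in_keys_iff lookup_add subset_iff)
  qed
  then have "h \<in> polys A"
    by (simp add: polys_def)
  then show thesis
    using eq by (rule that)
qed

lemma polys_0 [simp]: "0 \<in> polys A"
  by (simp add: polys_def)

lemma polys_1 [simp]: "1 \<in> polys A"
  by (simp add: polys_def)

lemma polys_uminus: "f \<in> polys A \<Longrightarrow> - f \<in> polys A"
  by (simp add: polys_def)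

lemma polys_monomial_iff: "monomial m \<in> polys A \<longleftrightarrow> Poly_Mapping.keys m \<subseteq> A"
  by (simp add: polys_def monomial_def)

lemma mdeg_superset:
  assumes "finite B" "Poly_Mapping.keys m \<subseteq> B"
  shows "mdeg m = (\<Sum>v\<in>B. Poly_Mapping.lookup m v)"
  unfolding mdeg_def using assms by (intro sum.mono_neutral_left) (auto simp: in_keys_iff)

lemma mdeg_add: "mdeg (m + m') = mdeg m + mdeg m'"
proof -
  let ?B = "Poly_Mapping.keys m \<union> Poly_Mapping.keys m'"
  have "Poly_Mapping.keys (m + m') \<subseteq> ?B"
    by (rule Poly_Mapping.keys_add)
  then show ?thesis
    by (simp add: mdeg_superset[of ?B] lookup_add sum.distrib)
qed

lemma homogeneous_0 [simp]: "homogeneous d 0"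
  by (simp add: homogeneous_def)

lemma homogeneous_add: "homogeneous d f \<Longrightarrow> homogeneous d g \<Longrightarrow> homogeneous d (f + g)"
  using Poly_Mapping.keys_add[of f g] unfolding homogeneous_def by blast

lemma homogeneous_uminus: "homogeneous d f \<Longrightarrow> homogeneous d (- f)"
  by (simp add: homogeneous_def)

lemma homogeneous_sum:
  "(\<And>a. a \<in> B \<Longrightarrow> homogeneous d (f a)) \<Longrightarrow> homogeneous d (sum f B)"
  by (induction B rule: infinite_finite_induct) (auto simp: homogeneous_add)

lemma homogeneous_mult: "homogeneous d f \<Longrightarrow> homogeneous e g \<Longrightarrow> homogeneous (d + e) (f * g)"
  using keys_mult[of f g] mdeg_add unfolding homogeneous_def by fastforce

lemma homogeneous_monomial: "homogeneous (mdeg m) (monomial m)"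
  by (simp add: homogeneous_def monomial_def)

lemma homogeneous_var: "homogeneous 1 (var v)"
  by (simp add: homogeneous_def var_def monomial_def mdeg_def)

section \<open>Monomial ideals\<close>

definition monomial_multiples ::
    "'v set \<Rightarrow> ('v \<Rightarrow>\<^sub>0 nat) set \<Rightarrow> ('v, 'k::field) mpoly set" where
  "monomial_multiples A M =
     {f \<in> polys A. \<forall>m\<in>Poly_Mapping.keys f. \<exists>m'\<in>M. \<exists>u. m = u + m'}"

lemma carrier_poly_ring [simp]: "carrier (poly_ring A) = polys A"
  by (simp add: poly_ring_def)

lemma ring_poly_ring: "ring (poly_ring A :: ('v, 'k::field) mpoly ring)"
  using cring_poly_ring cring.axioms(1) by blast

lemma ideal_poly_ringI:
  fixes I :: "('v, 'k::field) mpoly set"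
  assumes "I \<subseteq> polys A" "0 \<in> I"
    and "\<And>f g. f \<in> I \<Longrightarrow> g \<in> I \<Longrightarrow> f + g \<in> I"
    and mult: "\<And>f g. f \<in> I \<Longrightarrow> g \<in> polys A \<Longrightarrow> g * f \<in> I"
  shows "ideal I (poly_ring A)"
proof (rule idealI)
  interpret R: cring "poly_ring A :: ('v, 'k) mpoly ring"
    by (rule cring_poly_ring)
  show "ring (poly_ring A :: ('v, 'k) mpoly ring)"
    by (rule ring_poly_ring)
  show "subgroup I (add_monoid (poly_ring A))"
  proof (rule R.add.subgroupI)
    fix f assume f: "f \<in> I"
    then have f': "f \<in> polys A" using assms(1) by auto
    have "- f = \<ominus>\<^bsub>poly_ring A\<^esub> f"
    proof (rule R.minus_equality[symmetric])
      show "- f \<oplus>\<^bsub>poly_ring A\<^esub> f = \<zero>\<^bsub>poly_ring A\<^esub>"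
        by (simp add: poly_ring_def)
    qed (use f' in \<open>auto intro: polys_uminus\<close>)
    moreover have "- f \<in> I"
      using mult[OF f, of "- 1"] by (simp add: polys_uminus)
    ultimately show "\<ominus>\<^bsub>poly_ring A\<^esub> f \<in> I" by simp
  qed (use assms in \<open>auto simp: poly_ring_def\<close>)
qed (use mult in \<open>auto simp: poly_ring_def mult.commute\<close>)

lemma ideal_poly_ringD:
  fixes I :: "('v, 'k::field) mpoly set"
  assumes "ideal I (poly_ring A)"
  shows "0 \<in> I" and "f \<in> I \<Longrightarrow> g \<in> I \<Longrightarrow> f + g \<in> I"
    and "f \<in> I \<Longrightarrow> g \<in> polys A \<Longrightarrow> g * f \<in> I"
  using additive_subgroup.zero_closed[OF ideal.axioms(1)[OF assms]]
    additive_subgroup.a_closed[OF ideal.axioms(1)[OF assms]] ideal.I_l_closed[OF assms]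
  by (auto simp: poly_ring_def)

text \<open>
  A polynomial lies in a monomial ideal iff each of its terms does.  This reduces membership, colon
  ideals and minimality of generators to divisibility of exponent vectors.
\<close>

lemma genideal_monomials:
  fixes M :: "('v \<Rightarrow>\<^sub>0 nat) set"
  assumes M: "\<And>m. m \<in> M \<Longrightarrow> Poly_Mapping.keys m \<subseteq> A"
  shows "Idl\<^bsub>poly_ring A\<^esub> (monomial ` M) = (monomial_multiples A M :: ('v, 'k::field) mpoly set)"
proof
  interpret R: cring "poly_ring A :: ('v, 'k) mpoly ring"
    by (rule cring_poly_ring)
  let ?I = "Idl\<^bsub>poly_ring A\<^esub> (monomial ` M) :: ('v, 'k) mpoly set"
  let ?N = "monomial_multiples A M :: ('v, 'k) mpoly set"
  have gens: "monomial ` M \<subseteq> (polys A :: ('v, 'k) mpoly set)"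
    using M by (auto simp: polys_monomial_iff)
  have "ideal ?N (poly_ring A)"
  proof (rule ideal_poly_ringI)
    fix f g :: "('v, 'k) mpoly" assume "f \<in> ?N" "g \<in> ?N"
    then show "f + g \<in> ?N"
      using Poly_Mapping.keys_add[of f g] polys_add[of f A g] unfolding monomial_multiples_def by blast
  next
    fix f g :: "('v, 'k) mpoly" assume f: "f \<in> ?N" and g: "g \<in> polys A"
    have "\<exists>m'\<in>M. \<exists>u. m = u + m'" if m: "m \<in> Poly_Mapping.keys (g * f)" for m
    proof -
      obtain a b where ab: "b \<in> Poly_Mapping.keys f" "m = a + b"
        using m keys_mult[of g f] by blast
      then obtain m' u where "m' \<in> M" "b = u + m'"
        using f by (auto simp: monomial_multiples_def)
      then show ?thesis using ab(2) by (metis add.assoc)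
    qed
    then show "g * f \<in> ?N"
      using f g by (auto simp: monomial_multiples_def polys_mult)
  qed (auto simp: monomial_multiples_def)
  moreover have "monomial ` M \<subseteq> ?N"
  proof -
    have "\<exists>m'\<in>M. \<exists>u. m = u + m'" if "m \<in> M" for m
      using that by (metis add_0)
    then show ?thesis
      using gens by (auto simp: monomial_multiples_def monomial_def)
  qed
  ultimately show "?I \<subseteq> ?N"
    by (rule R.genideal_minimal)
  have I: "ideal ?I (poly_ring A)"
    using gens by (intro R.genideal_ideal) simp
  show "?N \<subseteq> ?I"
  proof
    fix f assume f: "f \<in> ?N"
    have "Poly_Mapping.single m c \<in> ?I" if m: "m \<in> Poly_Mapping.keys f" for m c
    proof -
      obtain m' u where m': "m' \<in> M" "m = u + m'"
        using f m by (auto simp: monomial_multiples_def)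
      have "Poly_Mapping.keys m \<subseteq> A"
        using f m by (auto simp: monomial_multiples_def polys_def)
      then have "Poly_Mapping.keys u \<subseteq> A"
        by (auto simp: m'(2) in_keys_iff lookup_add subset_iff)
      then have "Poly_Mapping.single u c \<in> polys A"
        by (simp add: polys_def)
      moreover have "monomial m' \<in> ?I"
        using R.genideal_self[of "monomial ` M"] gens m'(1) by auto
      ultimately have "Poly_Mapping.single u c * monomial m' \<in> ?I"
        using ideal_poly_ringD(3)[OF I] by blast
      then show ?thesis
        by (simp add: monomial_def mult_single m'(2))
    qed
    then have "(\<Sum>m\<in>B. Poly_Mapping.single m (Poly_Mapping.lookup f m)) \<in> ?I"
      if "B \<subseteq> Poly_Mapping.keys f" for B
      using that
      by (induction B rule: infinite_finite_induct) (auto intro: ideal_poly_ringD(1,2)[OF I])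
    from this[of "Poly_Mapping.keys f"] show "f \<in> ?I"
      by (simp add: sum_single_lookup)
  qed
qed

definition variable_multiples :: "'v set \<Rightarrow> 'v set \<Rightarrow> ('v, 'k::field) mpoly set" where
  "variable_multiples A V =
     {f \<in> polys A. \<forall>m\<in>Poly_Mapping.keys f. Poly_Mapping.keys m \<inter> V \<noteq> {}}"

lemma divisible_by_variable_iff:
  fixes m :: "'v \<Rightarrow>\<^sub>0 nat"
  shows "(\<exists>u. m = u + Poly_Mapping.single v 1) \<longleftrightarrow> v \<in> Poly_Mapping.keys m"
proof
  assume "v \<in> Poly_Mapping.keys m"
  then have "m = (m - Poly_Mapping.single v 1) + Poly_Mapping.single v 1"
    by (intro poly_mapping_eqI)
      (auto simp: lookup_add lookup_minus lookup_single in_keys_iff when_def)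
  then show "\<exists>u. m = u + Poly_Mapping.single v 1" by blast
qed (auto simp: in_keys_iff lookup_add)

lemma genideal_variables:
  assumes "V \<subseteq> A"
  shows "Idl\<^bsub>poly_ring A\<^esub> (var ` V) = (variable_multiples A V :: ('v, 'k::field) mpoly set)"
proof -
  let ?M = "(\<lambda>v. Poly_Mapping.single v (1::nat)) ` V"
  have "Idl\<^bsub>poly_ring A\<^esub> (monomial ` ?M) = (monomial_multiples A ?M :: ('v, 'k::field) mpoly set)"
    using assms by (intro genideal_monomials) auto
  moreover have "monomial ` ?M = (var ` V :: ('v, 'k::field) mpoly set)"
    by (auto simp: var_def image_image)
  moreover have "monomial_multiples A ?M = (variable_multiples A V :: ('v, 'k::field) mpoly set)"
    unfolding monomial_multiples_def variable_multiples_def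
    by (auto simp: divisible_by_variable_iff[unfolded One_nat_def])
  ultimately show ?thesis by simp
qed

lemma variable_multiples_empty: "variable_multiples A {} = {0}"
  by (auto simp: variable_multiples_def)

lemma variable_multiples_mono: "V \<subseteq> W \<Longrightarrow> variable_multiples A V \<subseteq> variable_multiples A W"
  by (auto simp: variable_multiples_def)

lemma variable_multiples_add:
  "f \<in> variable_multiples A V \<Longrightarrow> g \<in> variable_multiples A V \<Longrightarrow> f + g \<in> variable_multiples A V"
  using Poly_Mapping.keys_add[of f g] by (force simp: variable_multiples_def polys_add)

text \<open>
  A variable outside \<open>V\<close> is a nonzerodivisor modulo the ideal \<open>(V)\<close>, that is, \<open>(V) : x = (V)\<close>.  This
  is what makes the colon ideals of the syzygies be generated by variables again.
\<close>

lemma mult_var_mem_variable_multiples_iff: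
  fixes f :: "('v, 'k::field) mpoly"
  assumes "f \<in> polys A" "x \<in> A" "x \<notin> V"
  shows "f * var x \<in> variable_multiples A V \<longleftrightarrow> f \<in> variable_multiples A V"
proof -
  have "Poly_Mapping.keys (u + Poly_Mapping.single x (1::nat)) \<inter> V = Poly_Mapping.keys u \<inter> V" for u
    using assms(3) by (auto simp: in_keys_iff lookup_add lookup_single when_def split: if_splits)
  moreover have "f * var x \<in> polys A"
    using assms(1,2) by (simp add: polys_mult var_def polys_monomial_iff)
  ultimately show ?thesis
    using assms(1) by (simp add: variable_multiples_def var_def keys_mult_monomial)
qed

lemma mult_var_mem_variable_multiples:
  fixes f :: "('v, 'k::field) mpoly"
  assumes "f \<in> polys A" "x \<in> A" "x \<in> V"
  shows "f * var x \<in> variable_multiples A V"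
proof -
  have "x \<in> Poly_Mapping.keys (u + Poly_Mapping.single x (1::nat)) \<inter> V" for u
    using assms(3) by (simp add: in_keys_iff lookup_add)
  moreover have "f * var x \<in> polys A"
    using assms(1,2) by (simp add: polys_mult var_def polys_monomial_iff)
  ultimately show ?thesis
    by (auto simp: variable_multiples_def var_def keys_mult_monomial)
qed

lemma variable_multiples_insertE:
  fixes f :: "('v, 'k::field) mpoly"
  assumes f: "f \<in> variable_multiples A (insert x V)"
  obtains h f' where "h \<in> polys A" "f' \<in> variable_multiples A V" "f = f' + h * var x"
proof -
  obtain g f' where split: "f = g + f'"
      "Poly_Mapping.keys g = {m \<in> Poly_Mapping.keys f. x \<in> Poly_Mapping.keys m}"
      "Poly_Mapping.keys f' = {m \<in> Poly_Mapping.keys f. x \<notin> Poly_Mapping.keys m}"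
    by (rule split_by_monomials)
  have g: "g \<in> polys A"
    using f by (auto simp: split(2) variable_multiples_def polys_def)
  have dvd: "\<exists>u. m = u + Poly_Mapping.single x 1" if "m \<in> Poly_Mapping.keys g" for m
    using that by (simp add: split(2) divisible_by_variable_iff del: One_nat_def)
  obtain h where "h \<in> polys A" "g = h * monomial (Poly_Mapping.single x 1)"
    by (rule divide_by_monomial[OF dvd g])
  moreover have "f' \<in> variable_multiples A V"
    using f by (auto simp: split(3) variable_multiples_def polys_def)
  ultimately show thesis
    using that split(1) by (simp add: var_def add.commute)
qed

section \<open>Submodules of free modules\<close>

definition lin_comb ::
    "(nat \<Rightarrow> ('v, 'k::field) mpoly) list \<Rightarrow> (nat \<Rightarrow> ('v, 'k) mpoly) \<Rightarrow> nat \<Rightarrow> ('v, 'k) mpoly" where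
  "lin_comb gs v = diff_map (length gs) ((!) gs) v"

definition span :: "'v set \<Rightarrow> (nat \<Rightarrow> ('v, 'k::field) mpoly) list \<Rightarrow> (nat \<Rightarrow> ('v, 'k) mpoly) set" where
  "span A gs = lin_comb gs ` free_module A (length gs)"

definition syzygies ::
    "'v set \<Rightarrow> (nat \<Rightarrow> ('v, 'k::field) mpoly) list \<Rightarrow> (nat \<Rightarrow> ('v, 'k) mpoly) set" where
  "syzygies A gs = {v \<in> free_module A (length gs). lin_comb gs v = (\<lambda>_. 0)}"

lemma lin_comb_snoc:
  "lin_comb (gs @ [g]) v = (\<lambda>b. lin_comb gs v b + v (length gs) * g b)"
  by (simp add: lin_comb_def diff_map_def nth_append)

lemma lin_comb_cong: "(\<And>a. a < length gs \<Longrightarrow> v a = w a) \<Longrightarrow> lin_comb gs v = lin_comb gs w"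
  by (simp add: lin_comb_def diff_map_def)

lemma lin_comb_add: "lin_comb gs (\<lambda>a. v a + w a) = (\<lambda>b. lin_comb gs v b + lin_comb gs w b)"
  by (simp add: lin_comb_def diff_map_def algebra_simps sum.distrib)

lemma lin_comb_scale: "lin_comb gs (\<lambda>a. f * v a) = (\<lambda>b. f * lin_comb gs v b)"
  by (simp add: lin_comb_def diff_map_def sum_distrib_left mult.assoc)

lemma free_module_add:
  "v \<in> free_module A k \<Longrightarrow> w \<in> free_module A k \<Longrightarrow> (\<lambda>a. v a + w a) \<in> free_module A k"
  by (simp add: free_module_def polys_add)

lemma free_module_scale:
  "f \<in> polys A \<Longrightarrow> v \<in> free_module A k \<Longrightarrow> (\<lambda>a. f * v a) \<in> free_module A k"
  by (simp add: free_module_def polys_mult)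

lemma free_module_polys: "v \<in> free_module A k \<Longrightarrow> v a \<in> polys A"
  by (cases "a < k") (auto simp: free_module_def)

lemma free_module_Suc_iff: "v \<in> free_module A (Suc k) \<and> v k = 0 \<longleftrightarrow> v \<in> free_module A k"
  by (auto simp: free_module_def less_Suc_eq Suc_le_eq) (metis le_neq_implies_less)

lemma free_module_update:
  "v \<in> free_module A k \<Longrightarrow> f \<in> polys A \<Longrightarrow> v(k := f) \<in> free_module A (Suc k)"
  by (auto simp: free_module_def)

lemma span_Nil: "span A [] = {\<lambda>_. 0}"
  by (force simp: span_def lin_comb_def diff_map_def free_module_def)

text \<open>
  The recursion along which colon ideals, which always concern one vector and those before
  it, are compared with spans.
\<close>

lemma span_snoc:
  "span A (gs @ [g]) = {\<lambda>b. u b + f * g b | u f. u \<in> span A gs \<and> f \<in> polys A}" (is "?L = ?R")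
proof
  show "?L \<subseteq> ?R"
  proof
    fix y assume "y \<in> ?L"
    then obtain v where v: "v \<in> free_module A (Suc (length gs))" "y = lin_comb (gs @ [g]) v"
      by (auto simp: span_def)
    have "lin_comb gs v = lin_comb gs (v(length gs := 0))"
      by (rule lin_comb_cong) simp
    moreover have "v(length gs := 0) \<in> free_module A (length gs)"
      using v(1) by (auto simp: free_module_def less_Suc_eq Suc_le_eq)
    ultimately have "lin_comb gs v \<in> span A gs"
      by (simp add: span_def)
    moreover have "v (length gs) \<in> polys A"
      using v(1) by (rule free_module_polys)
    ultimately show "y \<in> ?R"
      unfolding v(2) lin_comb_snoc by blast
  qed
  show "?R \<subseteq> ?L"
  proof
    fix y assume "y \<in> ?R"
    then obtain v f where v: "v \<in> free_module A (length gs)" "f \<in> polys A"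
        "y = (\<lambda>b. lin_comb gs v b + f * g b)"
      by (auto simp: span_def)
    have "lin_comb gs (v(length gs := f)) = lin_comb gs v"
      by (rule lin_comb_cong) simp
    then have "y = lin_comb (gs @ [g]) (v(length gs := f))"
      by (simp add: v(3) lin_comb_snoc)
    then show "y \<in> ?L"
      using free_module_update[OF v(1,2)] by (simp add: span_def)
  qed
qed

lemma span_scale: "f \<in> polys A \<Longrightarrow> y \<in> span A gs \<Longrightarrow> (\<lambda>b. f * y b) \<in> span A gs"
  by (auto simp: span_def lin_comb_scale[symmetric] intro: free_module_scale)

lemma zero_in_span: "(\<lambda>_. 0) \<in> span A gs"
  unfolding span_def by (rule image_eqI[of _ _ "\<lambda>_. 0"]) (auto simp: lin_comb_def diff_map_def free_module_def)

lemma span_add: "y \<in> span A gs \<Longrightarrow> z \<in> span A gs \<Longrightarrow> (\<lambda>b. y b + z b) \<in> span A gs"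
  by (auto simp: span_def lin_comb_add[symmetric] intro: free_module_add)

lemma span_superset: "g \<in> set gs \<Longrightarrow> g \<in> span A gs"
proof (induction gs rule: rev_induct)
  case (snoc h gs)
  show ?case
  proof (cases "g = h")
    case True
    then show ?thesis
      unfolding span_snoc by (auto simp: zero_in_span intro!: exI[of _ "\<lambda>_. 0"] exI[of _ 1])
  next
    case False
    then have "g \<in> span A gs"
      using snoc by simp
    then show ?thesis
      unfolding span_snoc by (auto intro!: exI[of _ g] exI[of _ 0])
  qed
qed simp

lemma syzygies_add:
  "v \<in> syzygies A gs \<Longrightarrow> w \<in> syzygies A gs \<Longrightarrow> (\<lambda>a. v a + w a) \<in> syzygies A gs"
  by (simp add: syzygies_def free_module_add lin_comb_add)

lemma syzygies_scale:
  "f \<in> polys A \<Longrightarrow> v \<in> syzygies A gs \<Longrightarrow> (\<lambda>a. f * v a) \<in> syzygies A gs"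
  by (simp add: syzygies_def free_module_scale lin_comb_scale)

text \<open>
  Vectors are padded with zeros, so the syzygies of an initial segment are literally those syzygies
  of the longer list in which the later coefficients vanish.
\<close>

lemma syzygies_snoc_vanishing:
  "{v \<in> syzygies A (gs @ [g]). v (length gs) = 0} = syzygies A gs"
proof (rule Set.set_eqI)
  fix v
  show "v \<in> {v \<in> syzygies A (gs @ [g]). v (length gs) = 0} \<longleftrightarrow> v \<in> syzygies A gs"
    using free_module_Suc_iff[of v A "length gs"]
    by (cases "v (length gs) = 0") (auto simp: syzygies_def lin_comb_snoc)
qed

text \<open>
  The last coefficient of a syzygy lies in the colon ideal of the last vector: solve
  the relation for the term of that vector.
\<close>

lemma last_coeff_of_syzygy:
  assumes v: "v \<in> syzygies A (gs @ [g])"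
  shows "(\<lambda>b. v (length gs) * g b) \<in> span A gs"
proof -
  have "v \<in> free_module A (Suc (length gs))"
    using v by (simp add: syzygies_def)
  then have w: "(\<lambda>a. - 1 * (v(length gs := 0)) a) \<in> free_module A (length gs)"
    by (intro free_module_scale polys_uminus) (auto simp: free_module_def less_Suc_eq Suc_le_eq)
  have "lin_comb gs (\<lambda>a. - 1 * (v(length gs := 0)) a) = (\<lambda>b. - 1 * lin_comb gs v b)"
    unfolding lin_comb_scale by (subst lin_comb_cong[of gs "v(length gs := 0)" v]) auto
  also have "\<dots> = (\<lambda>b. v (length gs) * g b)"
  proof
    fix b
    have "lin_comb gs v b + v (length gs) * g b = 0"
      using v by (simp add: syzygies_def lin_comb_snoc fun_eq_iff)
    then show "- 1 * lin_comb gs v b = v (length gs) * g b"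
      by (simp add: neg_eq_iff_add_eq_0)
  qed
  finally show ?thesis
    using w unfolding span_def by (metis imageI)
qed

text \<open>
  Among the ways of writing a homogeneous vector as a combination of homogeneous ones there is one
  with homogeneous coefficients: keep only the degree \<open>d\<close> component of each coefficient.  The
  discarded terms contribute nothing in degree \<open>d + e\<close>, but their contribution is a difference of
  homogeneous vectors of that degree, so it vanishes.
\<close>

lemma homogeneous_coefficients:
  fixes gs :: "(nat \<Rightarrow> ('v, 'k::field) mpoly) list"
  assumes gs: "\<And>a b. a < length gs \<Longrightarrow> homogeneous e ((gs ! a) b)"
    and y: "y \<in> span A gs" "\<And>b. homogeneous (d + e) (y b)"
  obtains c where "c \<in> free_module A (length gs)" "\<And>a. homogeneous d (c a)" "y = lin_comb gs c"
proof -
  obtain v where v: "v \<in> free_module A (length gs)" "y = lin_comb gs v"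
    using y(1) by (auto simp: span_def)
  have "\<exists>g h. v a = g + h \<and> Poly_Mapping.keys g = {m \<in> Poly_Mapping.keys (v a). mdeg m = d}
      \<and> Poly_Mapping.keys h = {m \<in> Poly_Mapping.keys (v a). mdeg m \<noteq> d}" for a
    by (rule split_by_monomials[of "v a" "\<lambda>m. mdeg m = d"]) blast
  then obtain c c' where c: "\<And>a. v a = c a + c' a"
      "\<And>a. Poly_Mapping.keys (c a) = {m \<in> Poly_Mapping.keys (v a). mdeg m = d}"
      "\<And>a. Poly_Mapping.keys (c' a) = {m \<in> Poly_Mapping.keys (v a). mdeg m \<noteq> d}"
    by metis
  have "c a = 0" if "a \<ge> length gs" for a
  proof -
    have "v a = 0"
      using v(1) that by (simp add: free_module_def)
    then have "Poly_Mapping.keys (c a) = {}"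
      by (simp add: c(2))
    then show ?thesis by simp
  qed
  moreover have "c a \<in> polys A" for a
    using free_module_polys[OF v(1), of a] by (auto simp: polys_def c(2))
  ultimately have free: "c \<in> free_module A (length gs)"
    by (simp add: free_module_def)
  have hom: "homogeneous d (c a)" for a
    by (simp add: homogeneous_def c(2))
  have "v = (\<lambda>a. c a + c' a)"
    using c(1) by auto
  then have split: "y = (\<lambda>b. lin_comb gs c b + lin_comb gs c' b)"
    using lin_comb_add[of gs c c'] v(2) by simp
  have "lin_comb gs c' b = 0" for b
  proof -
    have "homogeneous (d + e) (lin_comb gs c b)"
      unfolding lin_comb_def diff_map_def using hom gs by (intro homogeneous_sum homogeneous_mult) auto
    then have "homogeneous (d + e) (y b + - lin_comb gs c b)"
      using y(2) by (intro homogeneous_add homogeneous_uminus)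
    then have "homogeneous (d + e) (lin_comb gs c' b)"
      by (simp add: split)
    moreover have "mdeg m \<noteq> d + e" if "m \<in> Poly_Mapping.keys (lin_comb gs c' b)" for m
    proof -
      have "m \<in> (\<Union>a<length gs. Poly_Mapping.keys (c' a * (gs ! a) b))"
        using that Poly_Mapping.keys_sum[of "\<lambda>a. c' a * (gs ! a) b" "{..<length gs}"]
        by (auto simp: lin_comb_def diff_map_def)
      then obtain a where a: "a < length gs" "m \<in> Poly_Mapping.keys (c' a * (gs ! a) b)"
        by auto
      then obtain p q where "p \<in> Poly_Mapping.keys (c' a)" "q \<in> Poly_Mapping.keys ((gs ! a) b)"
          "m = p + q"
        using keys_mult[of "c' a" "(gs ! a) b"] by blast
      then show ?thesis
        using gs[OF a(1), of b] by (simp add: c(3) homogeneous_def mdeg_add)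
    qed
    ultimately have "Poly_Mapping.keys (lin_comb gs c' b) = {}"
      unfolding homogeneous_def by blast
    then show ?thesis by simp
  qed
  then have "y = lin_comb gs c"
    by (simp add: split)
  with free hom show thesis
    by (rule that)
qed

section \<open>Linear quotients pass to syzygies\<close>

text \<open>
  Linear quotients for a submodule of a free module, presented by its list of generators.  The
  degree \<open>e\<close> is that of the polynomial entries, the basis of the free module being in degree 0.
  Finiteness of \<open>V\<close> keeps the module of syzygies finitely generated.
\<close>

inductive linear_quotient_list ::
    "'v set \<Rightarrow> nat \<Rightarrow> (nat \<Rightarrow> ('v, 'k::field) mpoly) list \<Rightarrow> bool" for A e where
  Nil: "linear_quotient_list A e []"
| snoc: "linear_quotient_list A e gs \<Longrightarrow> (\<And>b. g b \<in> polys A) \<Longrightarrow> (\<And>b. homogeneous e (g b)) \<Longrightarrow>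
    finite V \<Longrightarrow> V \<subseteq> A \<Longrightarrow>
    {f \<in> polys A. (\<lambda>b. f * g b) \<in> span A gs} = variable_multiples A V \<Longrightarrow>
    linear_quotient_list A e (gs @ [g])"

lemma linear_quotient_list_homogeneous:
  "linear_quotient_list A e gs \<Longrightarrow> a < length gs \<Longrightarrow> homogeneous e ((gs ! a) b)"
  by (induction arbitrary: a b rule: linear_quotient_list.induct)
    (auto simp: nth_append less_Suc_eq)

text \<open>
  The syzygy \<open>x e\<^sub>k - \<Sum>\<^bsub>i<k\<^esub> c\<^sub>i e\<^sub>i\<close> that records why \<open>x\<close> lies in the colon ideal of the last vector.
\<close>

lemma syzygy_of_variable:
  fixes gs :: "(nat \<Rightarrow> ('v, 'k::field) mpoly) list"
  assumes gs: "linear_quotient_list A e gs" and g: "\<And>b. homogeneous e (g b)"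
    and x: "x \<in> A" "(\<lambda>b. var x * g b) \<in> span A gs"
  obtains s where "s \<in> syzygies A (gs @ [g])" "s (length gs) = var x" "\<And>a. homogeneous 1 (s a)"
proof -
  have neg: "(\<lambda>b. - 1 * (var x * g b)) \<in> span A gs"
    using span_scale[OF polys_uminus[OF polys_1] x(2)] by simp
  have hom: "homogeneous (1 + e) (- 1 * (var x * g b))" for b
    using homogeneous_uminus[OF homogeneous_mult[OF homogeneous_var g]] by simp
  obtain c where c: "c \<in> free_module A (length gs)" "\<And>a. homogeneous 1 (c a)"
      "(\<lambda>b. - 1 * (var x * g b)) = lin_comb gs c"
    using homogeneous_coefficients[OF linear_quotient_list_homogeneous[OF gs] neg hom] by blast
  define s where "s = c(length gs := var x)"
  have "lin_comb gs s = lin_comb gs c"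
    by (rule lin_comb_cong) (simp add: s_def)
  then have "lin_comb (gs @ [g]) s = (\<lambda>_. 0)"
    by (simp add: lin_comb_snoc c(3)[symmetric] s_def)
  moreover have "s \<in> free_module A (Suc (length gs))"
    unfolding s_def using c(1) x(1)
    by (intro free_module_update) (auto simp: var_def polys_monomial_iff)
  ultimately have "s \<in> syzygies A (gs @ [g])"
    by (simp add: syzygies_def)
  moreover have "homogeneous 1 (s a)" for a
    by (simp add: s_def c(2) homogeneous_var del: One_nat_def)
  ultimately show thesis
    using that by (simp add: s_def)
qed

text \<open>
  Induction over the part \<open>W\<close> of the colon ideal's variables that has been treated.  For \<open>W = {}\<close> the
  described module consists of the syzygies of \<open>gs\<close>.  Adding the
  syzygy of a new variable \<open>x\<close> enlarges the ideal of admissible last coefficients from \<open>(W)\<close> to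
  \<open>(W, x)\<close>, and its colon ideal is \<open>(W) : x = (W)\<close>.
\<close>

lemma linear_quotient_list_syzygies_snoc:
  fixes gs :: "(nat \<Rightarrow> ('v, 'k::field) mpoly) list"
  assumes gs: "linear_quotient_list A e gs" and g: "\<And>b. homogeneous e (g b)"
    and ss: "linear_quotient_list A 1 ss" "set ss \<subseteq> free_module A (length gs)" "span A ss = syzygies A gs"
    and W: "finite W" "W \<subseteq> A" "\<And>x. x \<in> W \<Longrightarrow> (\<lambda>b. var x * g b) \<in> span A gs"
  shows "\<exists>ts. linear_quotient_list A 1 ts \<and> set ts \<subseteq> free_module A (Suc (length gs)) \<and>
    span A ts = {v \<in> syzygies A (gs @ [g]). v (length gs) \<in> variable_multiples A W}"
  using W
proof (induction W rule: finite_induct)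
  case empty
  have "set ss \<subseteq> free_module A (Suc (length gs))"
    using ss(2) free_module_Suc_iff by blast
  then show ?case
    using ss(1,3) syzygies_snoc_vanishing[of A gs g]
    by (intro exI[of _ ss]) (auto simp: variable_multiples_empty)
next
  case (insert x W)
  let ?k = "length gs"
  let ?Z = "syzygies A (gs @ [g])"
  obtain ts where ts: "linear_quotient_list A 1 ts" "set ts \<subseteq> free_module A (Suc ?k)"
      "span A ts = {v \<in> ?Z. v ?k \<in> variable_multiples A W}"
    using insert by auto
  have x: "x \<in> A" "(\<lambda>b. var x * g b) \<in> span A gs"
    using insert.prems by auto
  obtain s where s: "s \<in> ?Z" "s ?k = var x" "\<And>a. homogeneous 1 (s a)"
    using syzygy_of_variable[where g = g, OF gs g x] by blast
  have free: "s \<in> free_module A (Suc ?k)"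
    using s(1) by (simp add: syzygies_def)
  have colon: "{f \<in> polys A. (\<lambda>b. f * s b) \<in> span A ts} = variable_multiples A W"
  proof -
    have "(\<lambda>b. f * s b) \<in> span A ts \<longleftrightarrow> f \<in> variable_multiples A W" if "f \<in> polys A" for f
      using that s(1,2) x(1) insert.hyps(2)
      by (simp add: ts(3) syzygies_scale mult_var_mem_variable_multiples_iff)
    then show ?thesis
      by (auto simp: variable_multiples_def)
  qed
  have "linear_quotient_list A 1 (ts @ [s])"
    using ts(1) free_module_polys[OF free] s(3) insert.hyps(1) insert.prems(1) colon
    by (intro linear_quotient_list.snoc) auto
  moreover have "span A (ts @ [s]) = {v \<in> ?Z. v ?k \<in> variable_multiples A (insert x W)}"
    (is "?L = ?R")
  proof
    show "?L \<subseteq> ?R"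
    proof
      fix v assume "v \<in> ?L"
      then obtain u f where u: "u \<in> ?Z" "u ?k \<in> variable_multiples A W" "f \<in> polys A"
          "v = (\<lambda>b. u b + f * s b)"
        by (auto simp: span_snoc ts(3))
      have "u ?k + f * var x \<in> variable_multiples A (insert x W)"
        using u(2,3) x(1) variable_multiples_mono[of W "insert x W" A]
        by (intro variable_multiples_add mult_var_mem_variable_multiples) auto
      then show "v \<in> ?R"
        using u(1,3) s(1) by (simp add: u(4) s(2) syzygies_add syzygies_scale)
    qed
    show "?R \<subseteq> ?L"
    proof
      fix v assume v: "v \<in> ?R"
      then obtain h f' where h: "h \<in> polys A" "f' \<in> variable_multiples A W" "v ?k = f' + h * var x"
        by (auto elim: variable_multiples_insertE)
      define u where "u = (\<lambda>b. v b + - h * s b)"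
      have "u \<in> ?Z"
        unfolding u_def using v s(1) h(1) by (intro syzygies_add syzygies_scale polys_uminus) auto
      moreover have "u ?k = f'"
        by (simp add: u_def h(3) s(2))
      ultimately have "u \<in> span A ts"
        using h(2) by (simp add: ts(3))
      moreover have "v = (\<lambda>b. u b + h * s b)"
        by (simp add: u_def)
      ultimately show "v \<in> ?L"
        using h(1) by (auto simp: span_snoc)
    qed
  qed
  ultimately show ?case
    using ts(2) free by (intro exI[of _ "ts @ [s]"]) auto
qed

text \<open>
  The inductive heart of the resolution: once all variables of the colon ideal \<open>(V)\<close> of the last vector
  are treated, the condition on the last coefficient is void, since every syzygy has its last
  coefficient in \<open>(V)\<close>.
\<close>

theorem linear_quotient_list_syzygies:
  fixes gs :: "(nat \<Rightarrow> ('v, 'k::field) mpoly) list"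
  assumes "linear_quotient_list A e gs"
  shows "\<exists>ss. linear_quotient_list A 1 ss \<and> set ss \<subseteq> free_module A (length gs) \<and>
    span A ss = syzygies A gs"
  using assms
proof (induction rule: linear_quotient_list.induct)
  case Nil
  have "syzygies A [] = {\<lambda>_. (0::('v, 'k) mpoly)}"
    by (auto simp: syzygies_def free_module_def lin_comb_def diff_map_def)
  then show ?case
    by (intro exI[of _ "[]"]) (simp add: span_Nil linear_quotient_list.Nil)
next
  case (snoc gs g V)
  obtain ss where ss: "linear_quotient_list A 1 ss" "set ss \<subseteq> free_module A (length gs)"
      "span A ss = syzygies A gs"
    using snoc.IH by blast
  have "(\<lambda>b. var x * g b) \<in> span A gs" if "x \<in> V" for x
  proof -
    have "1 * var x \<in> (variable_multiples A V :: ('v, 'k) mpoly set)"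
      using that snoc.hyps(5) by (intro mult_var_mem_variable_multiples) auto
    then show ?thesis
      using snoc.hyps(6) by auto
  qed
  then obtain ts where ts: "linear_quotient_list A 1 ts" "set ts \<subseteq> free_module A (Suc (length gs))"
      "span A ts = {v \<in> syzygies A (gs @ [g]). v (length gs) \<in> variable_multiples A V}"
    using linear_quotient_list_syzygies_snoc[where g = g, OF snoc.hyps(1,3) ss snoc.hyps(4,5)] by blast
  have "v (length gs) \<in> variable_multiples A V" if "v \<in> syzygies A (gs @ [g])" for v
  proof -
    have "v (length gs) \<in> polys A"
      using that by (auto simp: syzygies_def intro: free_module_polys)
    then show ?thesis
      using last_coeff_of_syzygy[OF that] snoc.hyps(6) by blast
  qed
  then have "span A ts = syzygies A (gs @ [g])"
    by (auto simp: ts(3))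
  then show ?case
    using ts(1,2) by auto
qed

section \<open>The linear resolution\<close>

text \<open>
  Iterating the previous theorem gives a sequence of lists, each spanning the syzygies of the one
  before; these lists are the differentials.  The ideal enters as a submodule of the free module of
  rank 1.
\<close>

theorem linear_quotient_list_imp_linear_resolution:
  fixes gs :: "(nat \<Rightarrow> ('v, 'k::field) mpoly) list"
  assumes gs: "linear_quotient_list A d gs" and supp: "set gs \<subseteq> free_module A 1"
    and I: "(\<lambda>y. y 0) ` span A gs = I" and gen: "generated_in_degree A d I"
  shows "has_linear_resolution A I"
proof -
  \<comment> \<open>Only the generators of the ideal have degree \<open>d\<close>; all later vectors have linear entries.\<close>
  define P where "P i fs \<longleftrightarrow> linear_quotient_list A (if i = 0 then d else 1) fs \<and> (i = 0 \<longrightarrow> fs = gs)"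
    for i :: nat and fs
  define Q where "Q fs ss \<longleftrightarrow> set ss \<subseteq> free_module A (length fs) \<and> span A ss = syzygies A fs"
    for fs ss :: "(nat \<Rightarrow> ('v, 'k) mpoly) list"
  have "\<exists>F. \<forall>i. P i (F i) \<and> Q (F i) (F (Suc i))"
  proof (rule dependent_nat_choice)
    show "\<exists>fs. P 0 fs"
      using gs by (auto simp: P_def)
    show "\<exists>ss. P (Suc i) ss \<and> Q fs ss" if "P i fs" for fs i
      using that linear_quotient_list_syzygies unfolding P_def Q_def by force
  qed
  then obtain F where F: "\<And>i. P i (F i)" "\<And>i. Q (F i) (F (Suc i))"
    by blast
  have F0: "F 0 = gs"
    using F(1)[of 0] by (simp add: P_def)
  have FSuc: "linear_quotient_list A 1 (F (Suc i))" for i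
    using F(1)[of "Suc i"] by (simp add: P_def)
  define rk where "rk i = length (F i)" for i
  define sh where "sh i a = i + d" for i a :: nat
  define \<epsilon> where "\<epsilon> a = (gs ! a) 0" for a
  define D where "D i a = F (Suc i) ! a" for i a
  have diff_map: "diff_map (rk (Suc i)) (D i) = lin_comb (F (Suc i))" for i
    by (rule ext) (simp add: rk_def D_def[abs_def] lin_comb_def diff_map_def)
  have aug: "aug (rk 0) \<epsilon> v = lin_comb gs v 0" for v
    by (simp add: aug_def rk_def F0 \<epsilon>_def lin_comb_def diff_map_def)
  have exact: "syzygies A (F i) = lin_comb (F (Suc i)) ` free_module A (rk (Suc i))" for i
    using F(2)[of i] by (simp add: Q_def span_def rk_def)
  have kernel: "{v \<in> free_module A (rk 0). aug (rk 0) \<epsilon> v = 0} = syzygies A (F 0)"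
  proof -
    have vanish: "lin_comb gs v b = 0" if "b \<noteq> 0" for v b
    proof -
      have "(gs ! a) b = 0" if "a < length gs" for a
        using supp nth_mem[OF that] \<open>b \<noteq> 0\<close> by (auto simp: free_module_def)
      then show ?thesis by (simp add: lin_comb_def diff_map_def)
    qed
    have "lin_comb gs v 0 = 0 \<longleftrightarrow> lin_comb gs v = (\<lambda>_. 0)" for v
      unfolding fun_eq_iff using vanish by metis
    then show ?thesis
      unfolding aug syzygies_def by (simp add: rk_def F0)
  qed
  have D: "D i a \<in> free_module A (rk i)" if "a < rk (Suc i)" for i a
    using that F(2)[of i] by (auto simp: Q_def rk_def D_def subset_iff)
  have D_hom: "homogeneous 1 (D i a b)" if "a < rk (Suc i)" for i a b
    unfolding D_def using that by (intro linear_quotient_list_homogeneous[OF FSuc]) (simp add: rk_def)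
  have "minimal_graded_free_resolution A I rk sh \<epsilon> D"
    unfolding minimal_graded_free_resolution_def graded_free_resolution_def
  proof (intro conjI allI impI ballI)
    fix a assume "a < rk 0"
    then have a: "a < length gs"
      by (simp add: rk_def F0)
    show "\<epsilon> a \<in> polys A"
      using supp nth_mem[OF a] by (auto simp: \<epsilon>_def subset_iff intro: free_module_polys)
    show "homogeneous (sh 0 a) (\<epsilon> a)"
      using linear_quotient_list_homogeneous[OF gs a] by (simp add: sh_def \<epsilon>_def)
  next
    fix i a assume a: "a < rk (Suc i)"
    then show "D i a \<in> free_module A (rk i)"
      by (rule D)
    fix b assume "b < rk i"
    show "sh i b + mdeg m = sh (Suc i) a" if "m \<in> Poly_Mapping.keys (D i a b)" for m
      using D_hom[OF a, of b] that by (simp add: homogeneous_def sh_def)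
    \<comment> \<open>A linear form lies in the ideal of the variables, so minimality is automatic.\<close>
    have "Poly_Mapping.keys m \<inter> A \<noteq> {}" if m: "m \<in> Poly_Mapping.keys (D i a b)" for m
    proof -
      have "mdeg m = 1"
        using D_hom[OF a, of b] m by (simp add: homogeneous_def)
      then have "Poly_Mapping.keys m \<noteq> {}"
        by (auto simp: mdeg_def)
      moreover have "Poly_Mapping.keys m \<subseteq> A"
        using free_module_polys[OF D[OF a], of b] m by (auto simp: polys_def)
      ultimately show ?thesis by blast
    qed
    then show "D i a b \<in> Idl\<^bsub>poly_ring A\<^esub> (var ` A)"
      using free_module_polys[OF D[OF a], of b] by (simp add: genideal_variables variable_multiples_def)
  next
    show "aug (rk 0) \<epsilon> ` free_module A (rk 0) = I"
      unfolding I[symmetric] span_def image_image aug by (simp only: rk_def F0)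
    show "{v \<in> free_module A (rk 0). aug (rk 0) \<epsilon> v = 0} = diff_map (rk 1) (D 0) ` free_module A (rk 1)"
      using kernel exact[of 0] diff_map[of 0] unfolding One_nat_def by metis
    fix i
    show "{v \<in> free_module A (rk (Suc i)). diff_map (rk (Suc i)) (D i) v = (\<lambda>_. 0)}
        = diff_map (rk (Suc (Suc i))) (D (Suc i)) ` free_module A (rk (Suc (Suc i)))"
      using exact[of "Suc i"] unfolding diff_map by (simp only: syzygies_def rk_def)
  qed
  moreover have "graded_betti rk sh i j = 0" if "j \<noteq> i + d" for i j
    using that by (simp add: graded_betti_def sh_def)
  ultimately show ?thesis
    using gen unfolding has_linear_resolution_def by blast
qed

text \<open>
  The isomorphism of the polynomial ring with its free module of rank 1.
\<close>

definition embed :: "('v, 'k::field) mpoly \<Rightarrow> nat \<Rightarrow> ('v, 'k) mpoly" where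
  "embed f = (\<lambda>b. if b = 0 then f else 0)"

lemma embed_inject [simp]: "embed f = embed g \<longleftrightarrow> f = g"
  by (auto simp: embed_def fun_eq_iff)

lemma span_embed:
  fixes ms :: "('v, 'k::field) mpoly list"
  assumes ms: "set ms \<subseteq> polys A"
  shows "span A (map embed ms) = embed ` (Idl\<^bsub>poly_ring A\<^esub> (set ms))"
proof
  interpret R: cring "poly_ring A :: ('v, 'k) mpoly ring"
    by (rule cring_poly_ring)
  let ?I = "Idl\<^bsub>poly_ring A\<^esub> (set ms)"
  have I: "ideal ?I (poly_ring A)"
    using ms by (intro R.genideal_ideal) simp
  have gens: "set ms \<subseteq> ?I"
    using ms by (intro R.genideal_self) simp
  show sub: "span A (map embed ms) \<subseteq> embed ` ?I"
  proof
    fix y assume "y \<in> span A (map embed ms)"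
    then obtain v where v: "v \<in> free_module A (length ms)" "y = lin_comb (map embed ms) v"
      by (auto simp: span_def)
    have "v a * ms ! a \<in> ?I" if "a < length ms" for a
      using gens nth_mem[OF that] by (intro ideal_poly_ringD(3)[OF I] free_module_polys[OF v(1)]) blast
    then have "(\<Sum>a\<in>B. v a * ms ! a) \<in> ?I" if "B \<subseteq> {..<length ms}" for B
      using that by (induction B rule: infinite_finite_induct) (auto intro: ideal_poly_ringD(1,2)[OF I])
    then have "(\<Sum>a<length ms. v a * ms ! a) \<in> ?I" by blast
    moreover have "y = embed (\<Sum>a<length ms. v a * ms ! a)"
      by (rule ext) (simp add: v(2) lin_comb_def diff_map_def embed_def)
    ultimately show "y \<in> embed ` ?I" by blast
  qed
  let ?J = "{f. embed f \<in> span A (map embed ms)}"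
  have "ideal ?J (poly_ring A)"
  proof (rule ideal_poly_ringI)
    have "?J \<subseteq> ?I"
      using sub by auto
    also have "\<dots> \<subseteq> polys A"
      using additive_subgroup.a_subset[OF ideal.axioms(1)[OF I]] by simp
    finally show "?J \<subseteq> polys A" .
  next
    show "0 \<in> ?J"
      using zero_in_span[of A "map embed ms"] by (simp add: embed_def)
  next
    fix f g assume "f \<in> ?J" "g \<in> ?J"
    moreover have "embed (f + g) = (\<lambda>b. embed f b + embed g b)"
      by (auto simp: embed_def)
    ultimately show "f + g \<in> ?J"
      by (simp add: span_add)
  next
    fix f g :: "('v, 'k) mpoly" assume "f \<in> ?J" "g \<in> polys A"
    moreover have "embed (g * f) = (\<lambda>b. g * embed f b)"
      by (auto simp: embed_def)
    ultimately show "g * f \<in> ?J"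
      by (simp add: span_scale)
  qed
  moreover have "set ms \<subseteq> ?J"
    using span_superset[of _ "map embed ms" A] by auto
  ultimately have "?I \<subseteq> ?J"
    by (rule R.genideal_minimal)
  then show "embed ` ?I \<subseteq> span A (map embed ms)"
    by auto
qed

lemma linear_quotient_list_embed:
  fixes ms :: "('v, 'k::field) mpoly list"
  assumes "\<And>m. m \<in> set ms \<Longrightarrow> m \<in> polys A \<and> homogeneous d m"
    and "\<And>j. j < length ms \<Longrightarrow> \<exists>V\<subseteq>A. finite V \<and>
      colon_ideal A (Idl\<^bsub>poly_ring A\<^esub> (set (take j ms))) (ms ! j) = Idl\<^bsub>poly_ring A\<^esub> (var ` V)"
  shows "linear_quotient_list A d (map embed ms)"
  using assms
proof (induction ms rule: rev_induct)
  case Nil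
  show ?case by (simp add: linear_quotient_list.Nil)
next
  case (snoc m ms)
  have "\<exists>V\<subseteq>A. finite V \<and>
      colon_ideal A (Idl\<^bsub>poly_ring A\<^esub> (set (take j ms))) (ms ! j) = Idl\<^bsub>poly_ring A\<^esub> (var ` V)"
    if "j < length ms" for j
    using snoc.prems(2)[of j] that by (simp add: nth_append)
  then have IH: "linear_quotient_list A d (map embed ms)"
    using snoc.IH snoc.prems(1) by simp
  obtain V where V: "V \<subseteq> A" "finite V"
      "colon_ideal A (Idl\<^bsub>poly_ring A\<^esub> (set ms)) m = Idl\<^bsub>poly_ring A\<^esub> (var ` V)"
    using snoc.prems(2)[of "length ms"] by auto
  have ms: "set ms \<subseteq> polys A" and m: "m \<in> polys A" "homogeneous d m"
    using snoc.prems(1) by auto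
  have "(\<lambda>b. f * embed m b) = embed (f * m)" for f
    by (auto simp: embed_def)
  then have "{f \<in> polys A. (\<lambda>b. f * embed m b) \<in> span A (map embed ms)}
      = colon_ideal A (Idl\<^bsub>poly_ring A\<^esub> (set ms)) m"
    by (auto simp: span_embed[OF ms] colon_ideal_def)
  then have "{f \<in> polys A. (\<lambda>b. f * embed m b) \<in> span A (map embed ms)} = variable_multiples A V"
    using V(3) by (simp add: genideal_variables[OF V(1)])
  then have "linear_quotient_list A d (map embed ms @ [embed m])"
    using IH V(1,2) m by (intro linear_quotient_list.snoc) (auto simp: embed_def)
  then show ?case by simp
qed

theorem linear_quotients_imp_linear_resolution:
  fixes ms :: "('v, 'k::field) mpoly list"
  assumes ms: "\<And>m. m \<in> set ms \<Longrightarrow> m \<in> polys A \<and> homogeneous d m"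
    and "\<And>j. j < length ms \<Longrightarrow> \<exists>V\<subseteq>A. finite V \<and>
      colon_ideal A (Idl\<^bsub>poly_ring A\<^esub> (set (take j ms))) (ms ! j) = Idl\<^bsub>poly_ring A\<^esub> (var ` V)"
  shows "has_linear_resolution A (Idl\<^bsub>poly_ring A\<^esub> (set ms))"
proof (rule linear_quotient_list_imp_linear_resolution)
  show "linear_quotient_list A d (map embed ms)"
    using assms by (rule linear_quotient_list_embed)
  show "set (map embed ms) \<subseteq> free_module A 1"
    using ms by (auto simp: free_module_def embed_def)
  have "(\<lambda>y. y 0) ` embed ` X = X" for X :: "('v, 'k) mpoly set"
    by (simp add: image_image embed_def)
  moreover have "set ms \<subseteq> polys A"
    using ms by blast
  ultimately show "(\<lambda>y. y 0) ` span A (map embed ms) = Idl\<^bsub>poly_ring A\<^esub> (set ms)"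
    by (simp add: span_embed)
  show "generated_in_degree A d (Idl\<^bsub>poly_ring A\<^esub> (set ms))"
    unfolding generated_in_degree_def using ms by (intro exI[of _ "set ms"]) auto
qed

section \<open>Monomial ideals generated in one degree\<close>

lemma divides_iff_lookup_le:
  fixes m m' :: "'v \<Rightarrow>\<^sub>0 nat"
  shows "(\<exists>u. m = u + m') \<longleftrightarrow> (\<forall>v. Poly_Mapping.lookup m' v \<le> Poly_Mapping.lookup m v)"
proof
  assume "\<forall>v. Poly_Mapping.lookup m' v \<le> Poly_Mapping.lookup m v"
  then have "m = (m - m') + m'"
    by (intro poly_mapping_eqI) (simp add: lookup_add lookup_minus)
  then show "\<exists>u. m = u + m'" by blast
qed (auto simp: lookup_add)

text \<open>
  Since membership is decided term by term, a colon ideal by a monomial can be computed by testing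
  it on monomials \<open>u\<close> only.
\<close>

lemma colon_monomial_ideal:
  fixes M :: "('v \<Rightarrow>\<^sub>0 nat) set"
  assumes M: "\<And>m'. m' \<in> M \<Longrightarrow> Poly_Mapping.keys m' \<subseteq> A" and m: "Poly_Mapping.keys m \<subseteq> A"
    and V: "V \<subseteq> A"
    and iff: "\<And>u. Poly_Mapping.keys u \<subseteq> A \<Longrightarrow>
      (\<exists>m'\<in>M. \<exists>w. u + m = w + m') \<longleftrightarrow> Poly_Mapping.keys u \<inter> V \<noteq> {}"
  shows "colon_ideal A (Idl\<^bsub>poly_ring A\<^esub> (monomial ` M)) (monomial m)
      = (Idl\<^bsub>poly_ring A\<^esub> (var ` V) :: ('v, 'k::field) mpoly set)"
proof -
  have "f * monomial m \<in> monomial_multiples A M \<longleftrightarrow> f \<in> variable_multiples A V"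
    if f: "f \<in> polys A" for f :: "('v, 'k) mpoly"
  proof -
    have "f * monomial m \<in> polys A"
      using f m by (simp add: polys_mult polys_monomial_iff)
    moreover have "(\<exists>m'\<in>M. \<exists>w. u + m = w + m') \<longleftrightarrow> Poly_Mapping.keys u \<inter> V \<noteq> {}"
      if "u \<in> Poly_Mapping.keys f" for u
      using f that by (intro iff) (auto simp: polys_def)
    ultimately show ?thesis
      using f by (simp add: monomial_multiples_def variable_multiples_def keys_mult_monomial)
  qed
  then show ?thesis
    by (auto simp: colon_ideal_def genideal_monomials[OF M] genideal_variables[OF V]
        variable_multiples_def)
qed

text \<open>
  A proper divisor has smaller degree, so among monomials of equal degree none divides another one
  and no generator can be spared.
\<close>

lemma minimal_monomial_generators_same_degree:
  fixes M :: "('v \<Rightarrow>\<^sub>0 nat) set"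
  assumes M: "\<And>m. m \<in> M \<Longrightarrow> Poly_Mapping.keys m \<subseteq> A \<and> mdeg m = d"
  shows "minimal_monomial_generators A (Idl\<^bsub>poly_ring A\<^esub> (monomial ` M))
    (monomial ` M :: ('v, 'k::field) mpoly set)"
  unfolding minimal_monomial_generators_def
proof (intro conjI allI impI refl)
  show "monomial ` M \<subseteq> (monomials A :: ('v, 'k) mpoly set)"
    using M by (auto simp: monomials_def)
  fix G' :: "('v, 'k) mpoly set" assume G': "G' \<subset> monomial ` M"
  define M' where "M' = {m \<in> M. (monomial m :: ('v, 'k) mpoly) \<in> G'}"
  have G'_eq: "G' = monomial ` M'"
    using G' by (auto simp: M'_def)
  obtain m where m: "m \<in> M" "m \<notin> M'"
    using G' by (auto simp: G'_eq)
  have "m \<noteq> u + m'" if "m' \<in> M'" for u m'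
  proof
    assume eq: "m = u + m'"
    have m': "m' \<in> M"
      using that by (simp add: M'_def)
    have "mdeg u = 0"
      using M[OF m(1)] M[OF m'] by (simp add: eq mdeg_add)
    then have "u = 0"
      by (auto simp: mdeg_def in_keys_iff intro!: poly_mapping_eqI)
    then show False
      using m(2) that eq by simp
  qed
  then have "monomial m \<notin> (monomial_multiples A M' :: ('v, 'k) mpoly set)"
    by (auto simp: monomial_multiples_def monomial_def)
  moreover have "monomial m \<in> (monomial_multiples A M :: ('v, 'k) mpoly set)"
    using m(1) M[OF m(1)] by (auto simp: monomial_multiples_def monomial_def polys_def intro!: bexI[of _ m] exI[of _ 0])
  moreover have "Idl\<^bsub>poly_ring A\<^esub> (monomial ` M) = (monomial_multiples A M :: ('v, 'k) mpoly set)"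
    using M by (intro genideal_monomials) blast
  moreover have "Idl\<^bsub>poly_ring A\<^esub> G' = monomial_multiples A M'"
    unfolding G'_eq using M by (intro genideal_monomials) (auto simp: M'_def)
  ultimately show "Idl\<^bsub>poly_ring A\<^esub> G' \<noteq> Idl\<^bsub>poly_ring A\<^esub> (monomial ` M)"
    by auto
qed

section \<open>Co-letterplace ideals\<close>

definition graph_exponent :: "'p set \<Rightarrow> ('p \<Rightarrow> nat) \<Rightarrow> ('p \<times> nat) \<Rightarrow>\<^sub>0 nat" where
  "graph_exponent P \<phi> = (\<Sum>p\<in>P. Poly_Mapping.single (p, \<phi> p) 1)"

lemma lookup_graph_exponent:
  "finite P \<Longrightarrow> Poly_Mapping.lookup (graph_exponent P \<phi>) (p, i) = (if p \<in> P \<and> \<phi> p = i then 1 else 0)"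
proof -
  assume P: "finite P"
  have "Poly_Mapping.lookup (graph_exponent P \<phi>) (p, i) = (\<Sum>q\<in>P. if q = p then (if \<phi> p = i then 1 else 0) else 0)"
    unfolding graph_exponent_def lookup_sum
    by (rule sum.cong) (auto simp: lookup_single when_def)
  then show ?thesis
    using P by simp
qed

lemma keys_graph_exponent:
  "finite P \<Longrightarrow> Poly_Mapping.keys (graph_exponent P \<phi>) = (\<lambda>p. (p, \<phi> p)) ` P"
  by (auto simp: in_keys_iff lookup_graph_exponent split: if_splits)

lemma mdeg_graph_exponent:
  assumes "finite P"
  shows "mdeg (graph_exponent P \<phi>) = card P"
proof -
  have "mdeg (graph_exponent P \<phi>) = (\<Sum>p\<in>P. Poly_Mapping.lookup (graph_exponent P \<phi>) (p, \<phi> p))"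
    unfolding mdeg_def keys_graph_exponent[OF assms]
    by (subst sum.reindex) (auto simp: inj_on_def)
  then show ?thesis
    using assms by (simp add: lookup_graph_exponent)
qed

lemma prod_var_eq_monomial:
  "(\<Prod>p\<in>P. var (p, \<phi> p)) = (monomial (graph_exponent P \<phi>) :: ('p \<times> nat, 'k::field) mpoly)"
  by (induction P rule: infinite_finite_induct)
    (simp_all add: graph_exponent_def var_def monomial_def mult_single)

text \<open>
  The combinatorial core.  Let \<open>p\<close> be \<open>r\<close>-minimal among the points with \<open>\<psi> p < \<phi> p\<close>.  Lowering \<open>\<phi> p\<close>
  to \<open>\<psi> p\<close> cannot violate isotonicity towards points above \<open>p\<close>.  A point \<open>a\<close> below \<open>p\<close> has
  \<open>\<phi> a \<le> \<psi> a\<close> by minimality of \<open>p\<close>, hence \<open>\<phi> a \<le> \<psi> a \<le> \<psi> p\<close>.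
\<close>

lemma isotone_lowering:
  assumes P: "finite P" and r: "partial_order_on P r"
    and \<phi>: "\<phi> \<in> isotone_maps P r n" and \<psi>: "\<psi> \<in> isotone_maps P r n"
    and nle: "\<not> pointwise_le P \<phi> \<psi>"
  obtains p where "p \<in> P" "\<psi> p < \<phi> p" "\<phi>(p := \<psi> p) \<in> isotone_maps P r n"
proof -
  define S where "S = {p \<in> P. \<psi> p < \<phi> p}"
  define R where "R p q \<longleftrightarrow> (p, q) \<in> r \<and> p \<noteq> q" for p q
  have S: "finite S" "S \<noteq> {}"
    using P nle by (auto simp: S_def pointwise_le_def not_le)
  have "antisym r" "trans r"
    using r by (auto simp: partial_order_on_def preorder_on_def)
  then have "asymp_on S R" "transp_on S R"
    by (auto simp: R_def intro!: asymp_onI transp_onI dest: antisymD transD)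
  then obtain p where p: "p \<in> S" "\<And>q. q \<in> S \<Longrightarrow> q \<noteq> p \<Longrightarrow> \<not> R q p"
    using Finite_Set.bex_min_element[OF S(1) _ _ S(2), of R] by blast
  have pP: "p \<in> P" "\<psi> p < \<phi> p"
    using p(1) by (auto simp: S_def)
  have mono: "\<phi> a \<le> \<phi> b" "\<psi> a \<le> \<psi> b" if "a \<in> P" "b \<in> P" "(a, b) \<in> r" for a b
    using \<phi> \<psi> that by (auto simp: isotone_maps_def monotone_on_def)
  have "\<phi>(p := \<psi> p) \<in> P \<rightarrow>\<^sub>E {1..n}"
    using \<phi> \<psi> pP(1) by (auto simp: isotone_maps_def PiE_iff extensional_def)
  moreover have "(\<phi>(p := \<psi> p)) a \<le> (\<phi>(p := \<psi> p)) b" if ab: "a \<in> P" "b \<in> P" "(a, b) \<in> r" for a b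
  proof -
    consider "a = p" "b = p" | "a \<noteq> p" "b \<noteq> p" | "a = p" "b \<noteq> p" | "a \<noteq> p" "b = p"
      by blast
    then show ?thesis
    proof cases
      case 3
      then show ?thesis
        using mono(1)[OF ab] pP(2) by simp
    next
      case 4
      then have "a \<notin> S"
        using p(2)[of a] ab(3) by (auto simp: R_def)
      then have "\<phi> a \<le> \<psi> a"
        using ab(1) by (simp add: S_def not_less)
      also have "\<dots> \<le> \<psi> p"
        using mono(2)[OF ab] 4 by simp
      finally show ?thesis
        using 4 by simp
    qed (use mono(1)[OF ab] in simp_all)
  qed
  ultimately have "\<phi>(p := \<psi> p) \<in> isotone_maps P r n"
    unfolding isotone_maps_def monotone_on_def by blast
  then show thesis
    using that pP by blast
qed

text \<open>
  The sum of the values is strictly monotone in the pointwise order.  Hence a map that is listed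
  before \<open>\<phi>\<close> by increasing sums cannot lie pointwise above \<open>\<phi>\<close>.
\<close>

lemma pointwise_le_sum_antisym:
  assumes P: "finite P" and \<phi>: "\<phi> \<in> P \<rightarrow>\<^sub>E X" and \<psi>: "\<psi> \<in> P \<rightarrow>\<^sub>E X"
    and le: "pointwise_le P \<phi> \<psi>" and sum: "(\<Sum>p\<in>P. \<psi> p) \<le> (\<Sum>p\<in>P. \<phi> p)"
  shows "\<phi> = \<psi>"
proof (rule PiE_ext[OF \<phi> \<psi>])
  fix p assume p: "p \<in> P"
  have "\<not> \<phi> p < \<psi> p"
  proof
    assume "\<phi> p < \<psi> p"
    then have "(\<Sum>p\<in>P. \<phi> p) < (\<Sum>p\<in>P. \<psi> p)"
      using P p le by (intro sum_strict_mono_ex1) (auto simp: pointwise_le_def)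
    then show False
      using sum by simp
  qed
  then show "\<phi> p = \<psi> p"
    using le p by (force simp: pointwise_le_def)
qed

text \<open>
  The generators of the colon ideal of \<open>m\<^sub>\<phi>\<close>.
\<close>

definition lowering_variables :: "'p set \<Rightarrow> ('p \<Rightarrow> nat) set \<Rightarrow> ('p \<Rightarrow> nat) \<Rightarrow> ('p \<times> nat) set" where
  "lowering_variables P J \<phi> = {(p, i). p \<in> P \<and> i < \<phi> p \<and> \<phi>(p := i) \<in> J}"

text \<open>
  Here \<open>K\<close> stands for the maps listed before \<open>\<phi>\<close>.  All that matters about the order of the list is
  that it is by increasing sums; ties may be broken arbitrarily.  Left to right, a
  divisor \<open>m\<^sub>\<psi>\<close> of \<open>u m\<^sub>\<phi>\<close> needs its factor \<open>x\<^bsub>p,\<psi> p\<^esub>\<close> from \<open>u\<close> when \<open>\<psi> p \<noteq> \<phi> p\<close>, and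
  \<open>isotone_lowering\<close> provides such a \<open>p\<close> with \<open>\<phi>(p := \<psi> p)\<close> isotone, hence in \<open>J\<close>.  Right to left, the
  lowered map has a smaller sum and is therefore listed before \<open>\<phi>\<close>.
\<close>

lemma earlier_monomial_divides_iff:
  assumes P: "finite P" and r: "partial_order_on P r"
    and J: "poset_ideal (isotone_maps P r n) (pointwise_le P) J"
    and \<phi>: "\<phi> \<in> J" and K: "K \<subseteq> J" "\<phi> \<notin> K"
    and low: "\<And>\<psi>. \<psi> \<in> J \<Longrightarrow> (\<Sum>p\<in>P. \<psi> p) < (\<Sum>p\<in>P. \<phi> p) \<Longrightarrow> \<psi> \<in> K"
    and high: "\<And>\<psi>. \<psi> \<in> K \<Longrightarrow> (\<Sum>p\<in>P. \<psi> p) \<le> (\<Sum>p\<in>P. \<phi> p)"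
  shows "(\<exists>\<psi>\<in>K. \<exists>w. u + graph_exponent P \<phi> = w + graph_exponent P \<psi>)
    \<longleftrightarrow> Poly_Mapping.keys u \<inter> lowering_variables P J \<phi> \<noteq> {}"
proof
  have iso: "\<chi> \<in> isotone_maps P r n" if "\<chi> \<in> J" for \<chi>
    using J that by (auto simp: poset_ideal_def)
  assume "\<exists>\<psi>\<in>K. \<exists>w. u + graph_exponent P \<phi> = w + graph_exponent P \<psi>"
  then obtain \<psi> where \<psi>: "\<psi> \<in> K"
      and dvd: "Poly_Mapping.lookup (graph_exponent P \<psi>) v
        \<le> Poly_Mapping.lookup (u + graph_exponent P \<phi>) v" for v
    unfolding divides_iff_lookup_le by blast
  have \<psi>J: "\<psi> \<in> J"
    using \<psi> K(1) by blast
  have "\<not> pointwise_le P \<phi> \<psi>"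
  proof
    assume "pointwise_le P \<phi> \<psi>"
    then have "\<phi> = \<psi>"
      using high[OF \<psi>] iso[OF \<phi>] iso[OF \<psi>J]
      by (intro pointwise_le_sum_antisym[OF P]) (auto simp: isotone_maps_def)
    then show False
      using \<psi> K(2) by simp
  qed
  then obtain p where p: "p \<in> P" "\<psi> p < \<phi> p" "\<phi>(p := \<psi> p) \<in> isotone_maps P r n"
    using isotone_lowering[OF P r iso[OF \<phi>] iso[OF \<psi>J]] by blast
  have "pointwise_le P (\<phi>(p := \<psi> p)) \<phi>"
    using p(2) by (auto simp: pointwise_le_def)
  then have "\<phi>(p := \<psi> p) \<in> J"
    using J \<phi> p(3) unfolding poset_ideal_def by blast
  then have "(p, \<psi> p) \<in> lowering_variables P J \<phi>"
    using p(1,2) by (simp add: lowering_variables_def)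
  moreover have "(p, \<psi> p) \<in> Poly_Mapping.keys u"
    using dvd[of "(p, \<psi> p)"] p(1,2) P by (simp add: lookup_add lookup_graph_exponent in_keys_iff)
  ultimately show "Poly_Mapping.keys u \<inter> lowering_variables P J \<phi> \<noteq> {}" by blast
next
  assume "Poly_Mapping.keys u \<inter> lowering_variables P J \<phi> \<noteq> {}"
  then obtain p i where p: "p \<in> P" "i < \<phi> p" "\<phi>(p := i) \<in> J" and u: "(p, i) \<in> Poly_Mapping.keys u"
    by (auto simp: lowering_variables_def)
  have "(\<Sum>q\<in>P. (\<phi>(p := i)) q) < (\<Sum>q\<in>P. \<phi> q)"
    using P p(1,2) by (intro sum_strict_mono_ex1) auto
  then have "\<phi>(p := i) \<in> K"
    using low p(3) by blast
  moreover have "Poly_Mapping.lookup (graph_exponent P (\<phi>(p := i))) v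
      \<le> Poly_Mapping.lookup (u + graph_exponent P \<phi>) v" for v
    using P u by (cases v) (auto simp: lookup_add lookup_graph_exponent in_keys_iff Suc_le_eq)
  ultimately show "\<exists>\<psi>\<in>K. \<exists>w. u + graph_exponent P \<phi> = w + graph_exponent P \<psi>"
    unfolding divides_iff_lookup_le by blast
qed

theorem theorem5p1:
  fixes P :: "'p set" and r :: "'p rel" and n :: nat and J :: "('p \<Rightarrow> nat) set"
  assumes "n \<ge> 1"
    and "finite P"
    and "partial_order_on P r"
    and "poset_ideal (isotone_maps P r n) (pointwise_le P) J"
  shows "has_linear_quotients (P \<times> {1..n})
           (co_letterplace_ideal P n J :: ('p \<times> nat, 'k::field) mpoly set)
       \<and> has_linear_resolution (P \<times> {1..n})
           (co_letterplace_ideal P n J :: ('p \<times> nat, 'k) mpoly set)"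
proof -
  note P = assms(2) and r = assms(3) and J = assms(4)
  let ?A = "P \<times> {1..n}"
  let ?e = "graph_exponent P"
  let ?s = "\<lambda>\<phi>. \<Sum>p\<in>P. \<phi> p"
  have J_PiE: "J \<subseteq> P \<rightarrow>\<^sub>E {1..n}"
    using J by (auto simp: poset_ideal_def isotone_maps_def)
  then have "finite J"
    using P by (meson finite_PiE finite_atLeastAtMost finite_subset)
  then obtain \<phi>0 where \<phi>0: "set \<phi>0 = J" "distinct \<phi>0"
    using finite_distinct_list by blast
  define \<phi>s where "\<phi>s = sort_key ?s \<phi>0"
  have \<phi>s: "set \<phi>s = J" "distinct \<phi>s" "sorted (map ?s \<phi>s)"
    using \<phi>0 by (simp_all add: \<phi>s_def)
  define ms :: "('p \<times> nat, 'k) mpoly list" where "ms = map (\<lambda>\<phi>. monomial (?e \<phi>)) \<phi>s"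
  have range: "\<phi> p \<in> {1..n}" if "\<phi> \<in> J" "p \<in> P" for \<phi> p
    using J_PiE that by (auto simp: PiE_iff)
  have keys: "Poly_Mapping.keys (?e \<phi>) \<subseteq> ?A" if "\<phi> \<in> J" for \<phi>
    using range[OF that] by (auto simp: keys_graph_exponent[OF P])
  have set_ms: "set ms = monomial ` ?e ` J"
    by (auto simp: ms_def \<phi>s(1))
  have L: "co_letterplace_ideal P n J = Idl\<^bsub>poly_ring ?A\<^esub> (set ms)"
    by (simp add: co_letterplace_ideal_def prod_var_eq_monomial set_ms image_image)
  have colon: "\<exists>V\<subseteq>?A. finite V \<and>
      colon_ideal ?A (Idl\<^bsub>poly_ring ?A\<^esub> (set (take j ms))) (ms ! j) = Idl\<^bsub>poly_ring ?A\<^esub> (var ` V)"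
    if "j < length ms" for j
  proof -
    have j: "j < length \<phi>s"
      using that by (simp add: ms_def)
    define \<phi> where "\<phi> = \<phi>s ! j"
    define K where "K = set (take j \<phi>s)"
    have \<phi>J: "\<phi> \<in> J" and KJ: "K \<subseteq> J"
      using \<phi>s(1) j set_take_subset[of j \<phi>s] by (auto simp: \<phi>_def K_def)
    have K_iff: "\<psi> \<in> K \<longleftrightarrow> (\<exists>i<j. \<psi> = \<phi>s ! i)" for \<psi>
      using j by (auto simp: K_def in_set_conv_nth)
    have "\<phi> \<notin> K"
      using \<phi>s(2) j by (auto simp: K_iff \<phi>_def nth_eq_iff_index_eq)
    moreover have "\<psi> \<in> K" if \<psi>: "\<psi> \<in> J" "?s \<psi> < ?s \<phi>" for \<psi>
    proof -
      obtain i where i: "i < length \<phi>s" "\<psi> = \<phi>s ! i"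
        using \<psi>(1) \<phi>s(1) by (metis in_set_conv_nth)
      have "\<not> j \<le> i"
        using sorted_nth_mono[OF \<phi>s(3), of j i] i \<psi>(2) by (auto simp: \<phi>_def)
      then show ?thesis
        using i K_iff not_le by blast
    qed
    moreover have "?s \<psi> \<le> ?s \<phi>" if "\<psi> \<in> K" for \<psi>
      using that sorted_nth_mono[OF \<phi>s(3), of _ j] j by (auto simp: K_iff \<phi>_def)
    ultimately have iff: "(\<exists>\<psi>\<in>K. \<exists>w. u + ?e \<phi> = w + ?e \<psi>)
        \<longleftrightarrow> Poly_Mapping.keys u \<inter> lowering_variables P J \<phi> \<noteq> {}" for u
      by (intro earlier_monomial_divides_iff[OF P r J \<phi>J KJ]) auto
    have V: "lowering_variables P J \<phi> \<subseteq> ?A"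
    proof
      fix x assume "x \<in> lowering_variables P J \<phi>"
      then obtain p i where "x = (p, i)" "p \<in> P" "\<phi>(p := i) \<in> J"
        by (auto simp: lowering_variables_def)
      then show "x \<in> ?A"
        using range[of "\<phi>(p := i)" p] by simp
    qed
    have "colon_ideal ?A (Idl\<^bsub>poly_ring ?A\<^esub> (monomial ` ?e ` K)) (monomial (?e \<phi>))
        = (Idl\<^bsub>poly_ring ?A\<^esub> (var ` lowering_variables P J \<phi>) :: ('p \<times> nat, 'k) mpoly set)"
      using keys KJ \<phi>J V iff by (intro colon_monomial_ideal) auto
    moreover have "ms ! j = monomial (?e \<phi>)" "set (take j ms) = monomial ` ?e ` K"
      using j by (simp_all add: ms_def \<phi>_def K_def take_map image_image)
    moreover have "finite (lowering_variables P J \<phi>)"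
      using V P by (meson finite_SigmaI finite_atLeastAtMost finite_subset)
    ultimately show ?thesis
      using V by (intro exI[of _ "lowering_variables P J \<phi>"]) simp
  qed
  have "inj_on ?e J"
  proof (rule inj_onI)
    fix \<phi> \<psi> assume *: "\<phi> \<in> J" "\<psi> \<in> J" "?e \<phi> = ?e \<psi>"
    have "\<phi> p = \<psi> p" if "p \<in> P" for p
      using arg_cong[OF *(3), of "\<lambda>m. Poly_Mapping.lookup m (p, \<phi> p)"] that
      by (simp add: lookup_graph_exponent[OF P] split: if_splits)
    then show "\<phi> = \<psi>"
      using *(1,2) J_PiE by (meson PiE_ext subsetD)
  qed
  moreover have "inj_on (monomial :: _ \<Rightarrow> ('p \<times> nat, 'k) mpoly) (?e ` J)"
    by (auto simp: inj_on_def monomial_def dest!: arg_cong[of _ _ Poly_Mapping.keys])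
  ultimately have "distinct ms"
    using comp_inj_on[of ?e J "monomial :: _ \<Rightarrow> ('p \<times> nat, 'k) mpoly"]
    by (simp add: ms_def distinct_map \<phi>s(1,2) comp_def)
  moreover have "minimal_monomial_generators ?A (Idl\<^bsub>poly_ring ?A\<^esub> (set ms)) (set ms)"
    unfolding set_ms
    using keys mdeg_graph_exponent[OF P] by (intro minimal_monomial_generators_same_degree) blast
  moreover have "\<exists>V\<subseteq>?A. colon_ideal ?A (Idl\<^bsub>poly_ring ?A\<^esub> (set (take j ms))) (ms ! j)
      = Idl\<^bsub>poly_ring ?A\<^esub> (var ` V)" if "1 \<le> j \<and> j < length ms" for j
    using colon[of j] that by metis
  ultimately have "has_linear_quotients ?A (Idl\<^bsub>poly_ring ?A\<^esub> (set ms))"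
    unfolding has_linear_quotients_def by (intro exI[of _ ms]) simp
  moreover have "has_linear_resolution ?A (Idl\<^bsub>poly_ring ?A\<^esub> (set ms))"
  proof (rule linear_quotients_imp_linear_resolution[OF _ colon])
    fix m assume "m \<in> set ms"
    then obtain \<phi> where "\<phi> \<in> J" "m = monomial (?e \<phi>)"
      by (auto simp: set_ms)
    then show "m \<in> polys ?A \<and> homogeneous (card P) m"
      using keys homogeneous_monomial[of "?e \<phi>"]
      by (simp add: polys_monomial_iff mdeg_graph_exponent[OF P])
  qed
  ultimately show ?thesis
    by (simp add: L)
qed

end
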